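(* Given admissible coplanar end conditions for $\mathbf{P_{curve}}$, i.e. an admissible $(\mathbf x_1,\mathbf n_1)$ with $\mathbf e_z\cdot(\mathbf x_1\times\mathbf n_1)=0$, the unique cuspless stationary curve connecting $(\mathbf 0,\mathbf e_z)$ to $(\mathbf x_1,\mathbf n_1)$ is planar.
   Context: Throughout $\xi=1$. $\mathbf{P_{curve}}$: minimize $\int_0^L\sqrt{1+\kappa^2(s)}\,ds$ ($L$ free) among arclength-parametrized curves $\mathbf x$ in $\mathbb R^3$ with $\mathbf x(0)=\mathbf 0$, $\mathbf x'(0)=\mathbf e_z$, $\mathbf x(L)=\mathbf x_1$, $\mathbf x'(L)=\mathbf n_1\in S^2$. Its (cuspless) stationary curves are the curves $\mathbf x$ on $[0,L]$, $0<L\le s_{max}$, $L<\infty$, obtained as spatial projections of cuspless sub-Riemannian geodesics $\gamma=(\mathbf x,R)$ in $SE(3)$ with sixth momentum component $\lambda_6=0$: the momentum is $\lambda_1(s)=\lambda_1(0)\cosh s-\lambda_5(0)\sinh s$, $\lambda_5(s)=\lambda_5(0)\cosh s-\lambda_1(0)\sinh s$, $\lambda_2(s)=\lambda_2(0)\cosh s+\lambda_4(0)\sinh s$, $\lambda_4(s)=\lambda_4(0)\cosh s+\lambda_2(0)\sinh s$, $\lambda_3(s)=\sqrt{1-\lambda_4(s)^2-\lambda_5(s)^2}$, with $(\lambda_1,\lambda_2,\lambda_3)(0)\ne\mathbf 0$ and $\lambda_4(0)^2+\lambda_5(0)^2\le1$; $s_{max}\in(0,\infty]$ is the minimal $s>0$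 with $\lambda_3(s)=0$; $\gamma(0)=(\mathbf 0,I)$ and for $0<s<s_{max}$ $$\mathbf x'(s)=R(s)\mathbf e_z,\qquad R'(s)=\frac1{\lambda_3(s)}R(s)\begin{pmatrix}0&0&\lambda_5(s)\\0&0&-\lambda_4(s)\\-\lambda_5(s)&\lambda_4(s)&0\end{pmatrix}.$$ An end condition $(\mathbf x_1,\mathbf n_1)$ is admissible if it equals $(\mathbf x(L),\mathbf x'(L))$ for some such stationary curve. Coplanar end conditions means that $\mathbf e_z,\mathbf x_1,\mathbf n_1$ are coplanar. *)

theory Defs
  imports "HOL-Analysis.Analysis"
begin

definition e_z :: "real^3" where
  "e_z = vector [0, 0, 1]"

text \<open>
  Momentum along a geodesic with vanishing sixth component. The arguments \<open>l1 l2 l4 l5\<close> are the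
  initial values of the components 1, 2, 4 and 5; the third component is determined by the others,
  also at time 0.
\<close>

definition lam1 :: "real \<Rightarrow> real \<Rightarrow> real \<Rightarrow> real" where
  "lam1 l1 l5 s = l1 * cosh s - l5 * sinh s"

definition lam5 :: "real \<Rightarrow> real \<Rightarrow> real \<Rightarrow> real" where
  "lam5 l1 l5 s = l5 * cosh s - l1 * sinh s"

definition lam2 :: "real \<Rightarrow> real \<Rightarrow> real \<Rightarrow> real" where
  "lam2 l2 l4 s = l2 * cosh s + l4 * sinh s"

definition lam4 :: "real \<Rightarrow> real \<Rightarrow> real \<Rightarrow> real" where
  "lam4 l2 l4 s = l4 * cosh s + l2 * sinh s"

definition lam3 :: "real \<Rightarrow> real \<Rightarrow> real \<Rightarrow> real \<Rightarrow> real \<Rightarrow> real" where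
  "lam3 l1 l2 l4 l5 s = sqrt (1 - (lam4 l2 l4 s)\<^sup>2 - (lam5 l1 l5 s)\<^sup>2)"

text \<open>The infimum is attained when the set is nonempty, and is \<open>\<infinity>\<close> otherwise.\<close>

definition s_max :: "real \<Rightarrow> real \<Rightarrow> real \<Rightarrow> real \<Rightarrow> ereal" where
  "s_max l1 l2 l4 l5 = Inf (ereal ` {s. 0 < s \<and> lam3 l1 l2 l4 l5 s = 0})"

definition geodesic_domain :: "real \<Rightarrow> real \<Rightarrow> real \<Rightarrow> real \<Rightarrow> real set" where
  "geodesic_domain l1 l2 l4 l5 = {s. 0 \<le> s \<and> ereal s \<le> s_max l1 l2 l4 l5}"

text \<open>
  The HOL square root of a negative number is negative instead of undefined, so we have to require
  that \<open>lam3\<close> is the square root of a nonnegative number on the whole domain. This excludes exactly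
  the momenta with \<open>l4\<^sup>2 + l5\<^sup>2 = 1\<close> for which \<open>lam4\<^sup>2 + lam5\<^sup>2\<close> exceeds 1 immediately after time 0.
\<close>

definition admissible_momentum :: "real \<Rightarrow> real \<Rightarrow> real \<Rightarrow> real \<Rightarrow> bool" where
  "admissible_momentum l1 l2 l4 l5 \<longleftrightarrow>
     (lam1 l1 l5 0, lam2 l2 l4 0, lam3 l1 l2 l4 l5 0) \<noteq> (0, 0, 0) \<and>
     l4\<^sup>2 + l5\<^sup>2 \<le> 1 \<and>
     (\<forall>s \<in> geodesic_domain l1 l2 l4 l5. (lam4 l2 l4 s)\<^sup>2 + (lam5 l1 l5 s)\<^sup>2 \<le> 1)"

definition rotation_generator :: "real \<Rightarrow> real \<Rightarrow> real^3^3" where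
  "rotation_generator a b = vector [vector [0, 0, b], vector [0, 0, - a], vector [- b, a, 0]]"

text \<open>
  The differential equations are imposed on the open interval only, since \<open>lam3\<close> may vanish at the
  ends; at the ends the geodesic is continuous.
\<close>

definition cuspless_geodesic ::
  "real \<Rightarrow> real \<Rightarrow> real \<Rightarrow> real \<Rightarrow> (real \<Rightarrow> real^3) \<Rightarrow> (real \<Rightarrow> real^3^3) \<Rightarrow> bool" where
  "cuspless_geodesic l1 l2 l4 l5 x R \<longleftrightarrow>
     admissible_momentum l1 l2 l4 l5 \<and>
     (\<forall>s \<in> geodesic_domain l1 l2 l4 l5. rotation_matrix (R s)) \<and>
     continuous_on (geodesic_domain l1 l2 l4 l5) x \<and>
     continuous_on (geodesic_domain l1 l2 l4 l5) R \<and>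
     x 0 = 0 \<and> R 0 = mat 1 \<and>
     (\<forall>s. 0 < s \<and> ereal s < s_max l1 l2 l4 l5 \<longrightarrow>
        (x has_vector_derivative (R s *v e_z)) (at s) \<and>
        (R has_vector_derivative
           (1 / lam3 l1 l2 l4 l5 s) *\<^sub>R
             (R s ** rotation_generator (lam4 l2 l4 s) (lam5 l1 l5 s))) (at s))"

text \<open>The values of \<open>x\<close> outside \<open>{0..L}\<close> are irrelevant.\<close>

definition stationary_curve :: "real \<Rightarrow> (real \<Rightarrow> real^3) \<Rightarrow> bool" where
  "stationary_curve L x \<longleftrightarrow>
     0 < L \<and>
     (\<exists>l1 l2 l4 l5 y R. cuspless_geodesic l1 l2 l4 l5 y R \<and>
        ereal L \<le> s_max l1 l2 l4 l5 \<and> (\<forall>s \<in> {0..L}. x s = y s))"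

definition has_end_condition :: "real \<Rightarrow> (real \<Rightarrow> real^3) \<Rightarrow> real^3 \<Rightarrow> real^3 \<Rightarrow> bool" where
  "has_end_condition L x x1 n1 \<longleftrightarrow>
     x L = x1 \<and> (x has_vector_derivative n1) (at L within {0..L})"

definition connects :: "real \<Rightarrow> (real \<Rightarrow> real^3) \<Rightarrow> real^3 \<Rightarrow> real^3 \<Rightarrow> bool" where
  "connects L x x1 n1 \<longleftrightarrow>
     x 0 = 0 \<and> (x has_vector_derivative e_z) (at 0 within {0..L}) \<and> has_end_condition L x x1 n1"

definition admissible_end_condition :: "real^3 \<Rightarrow> real^3 \<Rightarrow> bool" where
  "admissible_end_condition x1 n1 \<longleftrightarrow>
     (\<exists>L x. stationary_curve L x \<and> has_end_condition L x x1 n1)"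

end

theory Submission
  imports Defs
begin

text \<open>
  In the spatial frame the momentum \<open>p\<close> is constant, the torque \<open>q\<close> satisfies \<open>q' = p \<times> n\<close>, and the
  direction satisfies \<open>\<lambda> n' = q \<times> n\<close> with \<open>\<lambda> = p \<bullet> n\<close> and \<open>|q|\<^sup>2 + \<lambda>\<^sup>2 = 1\<close>. Let \<open>y\<close> be normal to the end data with
  \<open>p \<bullet> y \<ge> 0\<close>. On an interval where \<open>n \<bullet> y < 0\<close> the torque that controls the growth of \<open>n \<bullet> y\<close> is
  strictly decreasing, so \<open>n \<bullet> y\<close> cannot return to \<open>0\<close>. Hence \<open>n \<bullet> y \<ge> 0\<close>, and as \<open>n \<bullet> y\<close> integrates
  to \<open>0\<close> the curve is planar.

  Two planar curves with the same end data coincide. If neither has an inflection and they turn in the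
  same sense, a calibration by \<open>p \<bullet> x + g(n)\<close> with \<open>|g'| = sqrt (1 - (p \<bullet> n)\<^sup>2)\<close> applies.
  If one of them has an inflection, its directions span less than a right angle; the curves are then
  compared as graphs over a common axis. Their slopes differ with both signs, since both graphs have
  the same end points, and the signs of the difference of the torques at the ends of the intervals
  where the slope difference is positive or negative are contradictory.
\<close>

text \<open>The obstacle is the cusps: \<open>p \<bullet> n\<close> may vanish at either end, and
  there \<open>\<bar>q\<bar> = 1\<close>, so the curvature blows up and initial value uniqueness
  cannot be started from an end point. The equations are therefore used in the open interval only,
  continuity carries them to the ends, and signs are read from quantities that have been cleared of
  the division by \<open>p \<bullet> n\<close>. Planarity uses nothing but the end data, so every
  competitor lies in the same plane; this reduces uniqueness to planar curves. There
  \<open>q'' = q\<close>, so \<open>q\<close> cannot change sign twice. At an inflection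
  \<open>p \<times> n\<close> has its least modulus and it keeps its sign throughout; as it is
  \<open>\<bar>p\<bar>\<close> times the sine of the angle from \<open>p\<close> to
  \<open>n\<close>, and that angle lies between \<open>-pi/2\<close> and \<open>pi/2\<close>, the
  directions span less than a right angle. Without inflection they may sweep up to a half turn,
  where no common axis need exist; hence the calibration. It needs a common sense of turning,
  because the torque must be one function of the direction; curves that turn in opposite senses end
  on opposite sides of the initial tangent.\<close>

lemma last_zero_before_negative:
  fixes f :: "real \<Rightarrow> real"
  assumes cont: "continuous_on {a..x} f" and "0 \<le> f a" "a \<le> x" "f x < 0"
  obtains c where "a \<le> c" "c < x" "f c = 0" "\<And>t. c < t \<Longrightarrow> t \<le> x \<Longrightarrow> f t < 0"
proof -
  have zero: "\<exists>t. s \<le> t \<and> t \<le> x \<and> f t = 0" if "a \<le> s" "s \<le> x" "0 \<le> f s" for s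
    using IVT2'[of f x 0 s] that assms continuous_on_subset[OF cont, of "{s..x}"] by auto
  define S where "S = {t \<in> {a..x}. f t = 0}"
  have "closed S" unfolding S_def
    by (rule continuous_closed_preimage_constant[OF cont]) simp
  moreover have "bounded S"
    by (rule bounded_subset[of "{a..x}"]) (auto simp: S_def)
  ultimately have "compact S"
    by (simp add: compact_eq_bounded_closed)
  moreover have "S \<noteq> {}"
    using zero[of a] assms unfolding S_def by auto
  ultimately obtain c where c: "c \<in> S" "\<And>t. t \<in> S \<Longrightarrow> t \<le> c"
    using compact_attains_sup[of S] by blast
  show ?thesis
  proof
    show "a \<le> c" "f c = 0" using c unfolding S_def by auto
    show "c < x" using c assms unfolding S_def by (cases "c = x") auto
    show "f t < 0" if t: "c < t" "t \<le> x" for t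
    proof (rule ccontr)
      assume "\<not> f t < 0"
      then obtain u where "t \<le> u" "u \<le> x" "f u = 0" using zero[of t] t \<open>a \<le> c\<close> by auto
      then have "u \<in> S" using t \<open>a \<le> c\<close> unfolding S_def by auto
      then show False using c(2) \<open>t \<le> u\<close> t by force
    qed
  qed
qed

lemma negative_component:
  fixes f :: "real \<Rightarrow> real"
  assumes cont: "continuous_on {a..b} f" and "f a = 0" "f b = 0" "x \<in> {a..b}" "f x < 0"
  obtains c d where "a \<le> c" "c < x" "x < d" "d \<le> b" "f c = 0" "f d = 0"
    "\<And>t. c < t \<Longrightarrow> t < d \<Longrightarrow> f t < 0"
proof -
  obtain c where c: "a \<le> c" "c < x" "f c = 0" "\<And>t. c < t \<Longrightarrow> t \<le> x \<Longrightarrow> f t < 0"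
    using last_zero_before_negative[of a x f] assms continuous_on_subset[OF cont, of "{a..x}"] by auto
  \<comment> \<open>Time reversal turns the first zero after \<open>x\<close> into a last zero
    before a negative value.\<close>
  have "continuous_on {-b..-x} (\<lambda>t. f (- t))"
    by (rule continuous_on_compose2[OF cont]) (use assms in \<open>auto intro!: continuous_intros\<close>)
  then obtain d where d: "-b \<le> d" "d < -x" "f (-d) = 0" "\<And>t. d < t \<Longrightarrow> t \<le> -x \<Longrightarrow> f (-t) < 0"
    using last_zero_before_negative[of "-b" "-x" "\<lambda>t. f (-t)"] assms by auto
  show ?thesis
  proof (rule that[of c "-d"])
    show "f t < 0" if "c < t" "t < - d" for t
      using c(4)[of t] d(4)[of "-t"] that by (cases "t \<le> x") auto
  qed (use c d in auto)
qed

lemma increasing_from_derivative: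
  fixes f :: "real \<Rightarrow> real"
  assumes "a < b" "continuous_on {a..b} f"
    and "\<And>s. a < s \<Longrightarrow> s < b \<Longrightarrow> (f has_real_derivative f' s) (at s)"
    and "\<And>s. a < s \<Longrightarrow> s < b \<Longrightarrow> 0 < f' s"
  shows "f a < f b"
  using DERIV_pos_imp_increasing_open[of a b f] assms by blast

lemma decreasing_from_derivative:
  fixes f :: "real \<Rightarrow> real"
  assumes "a < b" "continuous_on {a..b} f"
    and "\<And>s. a < s \<Longrightarrow> s < b \<Longrightarrow> (f has_real_derivative f' s) (at s)"
    and "\<And>s. a < s \<Longrightarrow> s < b \<Longrightarrow> f' s < 0"
  shows "f b < f a"
  using DERIV_neg_imp_decreasing_open[of a b f] assms by blast

text \<open>The sign of the derivative is required near \<open>c\<close> but not at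
  \<open>c\<close>: in the applications \<open>c\<close> may be a cusp, where the derivative need
  not exist.\<close>

lemma positive_right_of_zero:
  fixes f :: "real \<Rightarrow> real"
  assumes "c < d" "continuous_on {c..d} f" "f c = 0"
    and "\<And>s. c < s \<Longrightarrow> s < d \<Longrightarrow> (f has_real_derivative f' s) (at s)"
    and "0 < e" "\<And>s. c < s \<Longrightarrow> s < d \<Longrightarrow> \<bar>s - c\<bar> < e \<Longrightarrow> 0 < f' s"
  shows "\<exists>s. c < s \<and> s < d \<and> 0 < f s"
proof -
  obtain m where m: "c < m" "m < min d (c + e)"
    using dense[of c "min d (c + e)"] assms(1,5) by auto
  have "f c < f m"
    by (rule increasing_from_derivative[where f' = f']) (use m assms continuous_on_subset[OF assms(2), of "{c..m}"] in auto)
  then show ?thesis using m assms by auto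
qed

lemma positive_left_of_zero:
  fixes f :: "real \<Rightarrow> real"
  assumes "c < d" "continuous_on {c..d} f" "f d = 0"
    and "\<And>s. c < s \<Longrightarrow> s < d \<Longrightarrow> (f has_real_derivative f' s) (at s)"
    and "0 < e" "\<And>s. c < s \<Longrightarrow> s < d \<Longrightarrow> \<bar>s - d\<bar> < e \<Longrightarrow> f' s < 0"
  shows "\<exists>s. c < s \<and> s < d \<and> 0 < f s"
proof -
  obtain m where m: "max c (d - e) < m" "m < d"
    using dense[of "max c (d - e)" d] assms(1,5) by auto
  have "f d < f m"
    by (rule decreasing_from_derivative[where f' = f']) (use m assms continuous_on_subset[OF assms(2), of "{m..d}"] in auto)
  then show ?thesis using m assms by auto
qed

text \<open>\<open>h\<close> is the inverse of \<open>g\<close> composed with \<open>f\<close>. In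
  the application \<open>f\<close> and \<open>g\<close> are the abscissae of two curves, and
  \<open>h\<close> sends a time on the first curve to the time at which the second is over the same
  point of the axis.\<close>

lemma increasing_reparametrization:
  fixes f g :: "real \<Rightarrow> real"
  assumes L: "0 < L" "0 < M"
    and cont: "continuous_on {0..L} f" "continuous_on {0..M} g"
    and df: "\<And>s. 0 < s \<Longrightarrow> s < L \<Longrightarrow> (f has_real_derivative f' s) (at s)" "\<And>s. 0 < s \<Longrightarrow> s < L \<Longrightarrow> 0 < f' s"
    and dg: "\<And>s. 0 < s \<Longrightarrow> s < M \<Longrightarrow> (g has_real_derivative g' s) (at s)" "\<And>s. 0 < s \<Longrightarrow> s < M \<Longrightarrow> 0 < g' s"
    and ends: "f 0 = g 0" "f L = g M"
  obtains h where "continuous_on {0..L} h" "h 0 = 0" "h L = M"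
    "\<And>s. 0 \<le> s \<Longrightarrow> s \<le> L \<Longrightarrow> g (h s) = f s"
    "\<And>s t. 0 \<le> s \<Longrightarrow> s < t \<Longrightarrow> t \<le> L \<Longrightarrow> h s < h t"
    "\<And>s. 0 \<le> s \<Longrightarrow> s \<le> L \<Longrightarrow> 0 \<le> h s \<and> h s \<le> M"
    "\<And>s. 0 < s \<Longrightarrow> s < L \<Longrightarrow> 0 < h s \<and> h s < M"
    "\<And>s. 0 < s \<Longrightarrow> s < L \<Longrightarrow> (h has_real_derivative f' s / g' (h s)) (at s)"
proof -
  have fmono: "f s < f t" if "0 \<le> s" "s < t" "t \<le> L" for s t
    by (rule increasing_from_derivative[where f' = f']) (use that df continuous_on_subset[OF cont(1), of "{s..t}"] in auto)
  have gmono: "g s < g t" if "0 \<le> s" "s < t" "t \<le> M" for s t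
    by (rule increasing_from_derivative[where f' = g']) (use that dg continuous_on_subset[OF cont(2), of "{s..t}"] in auto)
  have inj: "inj_on g {0..M}"
  proof (rule inj_onI)
    fix x y assume "x \<in> {0..M}" "y \<in> {0..M}" "g x = g y"
    then show "x = y" using gmono[of x y] gmono[of y x] by (cases x y rule: linorder_cases) auto
  qed
  have img: "g ` {0..M} = {g 0..g M}"
  proof
    show "g ` {0..M} \<subseteq> {g 0..g M}"
    proof
      fix y assume "y \<in> g ` {0..M}"
      then obtain x where "y = g x" "0 \<le> x" "x \<le> M" by auto
      then show "y \<in> {g 0..g M}" using gmono[of 0 x] gmono[of x M] by (cases "x = 0"; cases "x = M") auto
    qed
    show "{g 0..g M} \<subseteq> g ` {0..M}"
    proof
      fix y assume "y \<in> {g 0..g M}"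
      then obtain x where "0 \<le> x" "x \<le> M" "g x = y" using IVT'[of g 0 y M] cont(2) L by auto
      then show "y \<in> g ` {0..M}" by auto
    qed
  qed
  define k where "k = the_inv_into {0..M} g"
  have kcont: "continuous_on {g 0..g M} k"
    using continuous_on_inv_into[OF cont(2) _ inj] img unfolding k_def by simp
  have gk: "g (k t) = t" if "g 0 \<le> t" "t \<le> g M" for t
    unfolding k_def using f_the_inv_into_f[OF inj, of t] img that by auto
  have kg: "k (g t) = t" if "0 \<le> t" "t \<le> M" for t
    unfolding k_def using the_inv_into_f_f[OF inj, of t] that by auto
  have krange: "0 \<le> k t \<and> k t \<le> M" if "g 0 \<le> t" "t \<le> g M" for t
    using the_inv_into_into[OF inj, of t "{0..M}"] img that unfolding k_def by auto
  have frange: "g 0 \<le> f s" "f s \<le> g M" if "0 \<le> s" "s \<le> L" for s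
    using fmono[of 0 s] fmono[of s L] that ends by (cases "s = 0"; cases "s = L"; auto)+
  define h where "h = (\<lambda>s. k (f s))"
  have hmono: "h s < h t" if "0 \<le> s" "s < t" "t \<le> L" for s t
  proof (rule ccontr)
    assume "\<not> h s < h t"
    moreover have "0 \<le> h t" "h s \<le> M" using krange frange that unfolding h_def by auto
    ultimately have "g (h t) \<le> g (h s)"
      using gmono[of "h t" "h s"] by (cases "h t = h s") auto
    moreover have "g (h t) = f t" "g (h s) = f s" using gk frange that unfolding h_def by auto
    ultimately show False using fmono[OF that] by simp
  qed
  have h0: "h 0 = 0" "h L = M" using kg[of 0] kg[of M] ends L unfolding h_def by simp_all
  have hint: "0 < h s \<and> h s < M" if "0 < s" "s < L" for s
    using hmono[of 0 s] hmono[of s L] that h0 by auto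
  show ?thesis
  proof (rule that[of h])
    show "continuous_on {0..L} h" unfolding h_def
      by (rule continuous_on_compose2[OF kcont cont(1)]) (use frange in auto)
    show "g (h s) = f s" if "0 \<le> s" "s \<le> L" for s using gk frange that unfolding h_def by auto
    show "0 \<le> h s \<and> h s \<le> M" if "0 \<le> s" "s \<le> L" for s
      using krange frange that unfolding h_def by auto
    show "(h has_real_derivative f' s / g' (h s)) (at s)" if s: "0 < s" "s < L" for s
    proof -
      have fs: "g 0 < f s" "f s < g M" using fmono[of 0 s] fmono[of s L] s ends by auto
      have "isCont k (f s)"
        using continuous_on_interior[OF kcont] fs by auto
      then have "(k has_real_derivative inverse (g' (k (f s)))) (at (f s))"
        using hint[OF s] dg[of "k (f s)"] fs gk
        by (intro DERIV_inverse_function[of g _ k _ "g 0" "g M"]) (auto simp: h_def)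
      from DERIV_chain2[OF this df(1)[OF s]] show ?thesis
        unfolding h_def by (simp add: field_simps)
    qed
  qed (use h0 hmono hint in auto)
qed

section \<open>Three-point sign rule for the solutions of \<open>f'' = f\<close>\<close>

lemma hyperbolic_interpolation:
  fixes a b s t u :: real
  defines "f \<equiv> (\<lambda>s. b * cosh s + a * sinh s)"
  shows "f t * sinh (u - s) = f s * sinh (u - t) + f u * sinh (t - s)"
  unfolding f_def by (simp add: sinh_diff algebra_simps)

text \<open>For \<open>s < t < u\<close> the three-point identity writes \<open>f t\<close> as a
  combination of \<open>f s\<close> and \<open>f u\<close> with positive weights.\<close>

lemma hyperbolic_negative_between:
  fixes a b s t u :: real
  defines "f \<equiv> (\<lambda>s. b * cosh s + a * sinh s)"
  assumes "s < t" "t < u" "f s < 0" "f u < 0"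
  shows "f t < 0"
proof -
  have "f t * sinh (u - s) = f s * sinh (u - t) + f u * sinh (t - s)"
    unfolding f_def by (rule hyperbolic_interpolation)
  also have "\<dots> < 0" using assms by (intro add_neg_neg mult_neg_pos) auto
  finally show ?thesis using assms by (auto simp: mult_less_0_iff)
qed

section \<open>Planar geodesics\<close>

lemma eventually_positive_near:
  fixes f :: "real \<Rightarrow> real"
  assumes "continuous_on S f" "x \<in> S" "0 < f x"
  obtains e where "0 < e" "\<And>y. y \<in> S \<Longrightarrow> \<bar>y - x\<bar> < e \<Longrightarrow> 0 < f y"
proof -
  obtain e where "0 < e" "\<And>y. y \<in> S \<Longrightarrow> dist y x < e \<Longrightarrow> dist (f y) (f x) < f x"
    using assms unfolding continuous_on_iff by metis
  then show ?thesis
    using that[of e] unfolding dist_real_def by (smt (verit))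
qed

lemma unit_complex_eq_of_slope_eq:
  assumes "cmod u = 1" "cmod v = 1" "0 < Re u" "0 < Re v" "Im u / Re u = Im v / Re v"
  shows "u = v"
proof -
  define w where "w = Im u / Re u"
  have *: "(Re x)\<^sup>2 * (1 + w\<^sup>2) = 1" "Im x = w * Re x" if "x = u \<or> x = v" for x
  proof -
    show "Im x = w * Re x" using that assms unfolding w_def by (auto simp: field_simps)
    moreover have "(Re x)\<^sup>2 + (Im x)\<^sup>2 = 1" using that assms cmod_power2[of x] by auto
    ultimately show "(Re x)\<^sup>2 * (1 + w\<^sup>2) = 1" by (simp add: power_mult_distrib algebra_simps)
  qed
  have "1 + w\<^sup>2 > 0" by (simp add: add_pos_nonneg)
  then have "(Re u)\<^sup>2 = (Re v)\<^sup>2" using *(1)[of u] *(1)[of v] by (metis mult_right_cancel less_irrefl)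
  then have "Re u = Re v" using assms by (simp add: power2_eq_iff_nonneg)
  then show ?thesis using *(2)[of u] *(2)[of v] by (simp add: complex_eq_iff)
qed

text \<open>With \<open>q = sin \<phi>\<close>, \<open>l = cos \<phi>\<close> and likewise for the
  primed pair, both angles lie between \<open>-pi/2\<close> and \<open>pi/2\<close>, and the claim
  says that the sine of their difference is positive. It can fail only for a difference of exactly
  \<open>pi\<close>, that is \<open>q = 1\<close>, \<open>q' = -1\<close>; the last hypothesis
  excludes this together with all other pairs \<open>q' < 0 < q\<close>.\<close>

lemma unit_pair_cross_mono:
  fixes q q' l l' :: real
  assumes "q\<^sup>2 + l\<^sup>2 = 1" "q'\<^sup>2 + l'\<^sup>2 = 1" "0 \<le> l" "0 \<le> l'" "q' < q" "\<not> (0 < q \<and> q' < 0)"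
  shows "q' * l < q * l'"
proof (cases "0 < q")
  case True
  then have "q' * l \<le> q * l" using assms by (intro mult_right_mono) auto
  moreover have "l < l'"
  proof -
    have "q'\<^sup>2 < q\<^sup>2" using True assms by (intro power_strict_mono) auto
    then have "l\<^sup>2 < l'\<^sup>2" using assms by linarith
    then show ?thesis using assms power_less_imp_less_base by blast
  qed
  ultimately show ?thesis using True by (smt (verit) mult_strict_left_mono)
next
  case False
  have "(-q)\<^sup>2 < (-q')\<^sup>2" using False assms by (intro power_strict_mono) auto
  then have "l'\<^sup>2 < l\<^sup>2" using assms by simp
  then have "l' < l" using assms power_less_imp_less_base by blast
  then have "q' * l < q * l" "q * l \<le> q * l'"
    using False assms by (auto intro: mult_left_mono_neg)
  then show ?thesis by simp
qed

lemma inner_mult_unit: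
  fixes u :: complex
  assumes "cmod u = 1" shows "(u * a) \<bullet> (u * b) = a \<bullet> b"
proof -
  have "(u * a) \<bullet> (u * b) = ((Re u)\<^sup>2 + (Im u)\<^sup>2) * (a \<bullet> b)"
    unfolding inner_complex_def by simp algebra
  then show ?thesis using assms cmod_power2[of u] by simp
qed

text \<open>The plane is the complex plane and the torque is a scalar, its component normal to the
  plane; \<open>Im (cnj p * n)\<close> is the determinant of \<open>p\<close> and \<open>n\<close>.
  Positivity of \<open>p \<bullet> n\<close> is required in the interior only, since both ends may
  be cusps.\<close>

locale planar_geodesic =
  fixes L :: real and p :: complex and z n :: "real \<Rightarrow> complex" and q :: "real \<Rightarrow> real"
  assumes L_pos: "0 < L"
    and cont_z: "continuous_on {0..L} z"
    and cont_n: "continuous_on {0..L} n"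
    and cont_q: "continuous_on {0..L} q"
    and norm_n: "\<And>s. 0 \<le> s \<Longrightarrow> s \<le> L \<Longrightarrow> cmod (n s) = 1"
    and lam_nonneg: "\<And>s. 0 \<le> s \<Longrightarrow> s \<le> L \<Longrightarrow> 0 \<le> p \<bullet> n s"
    and energy: "\<And>s. 0 \<le> s \<Longrightarrow> s \<le> L \<Longrightarrow> (q s)\<^sup>2 + (p \<bullet> n s)\<^sup>2 = 1"
    and lam_pos: "\<And>s. 0 < s \<Longrightarrow> s < L \<Longrightarrow> 0 < p \<bullet> n s"
    and dz: "\<And>s. 0 < s \<Longrightarrow> s < L \<Longrightarrow> (z has_vector_derivative n s) (at s)"
    and dn: "\<And>s. 0 < s \<Longrightarrow> s < L \<Longrightarrow>
      (n has_vector_derivative \<i> * complex_of_real (q s / (p \<bullet> n s)) * n s) (at s)"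
    and dq: "\<And>s. 0 < s \<Longrightarrow> s < L \<Longrightarrow> (q has_real_derivative Im (cnj p * n s)) (at s)"
begin

abbreviation "lam s \<equiv> p \<bullet> n s"
abbreviation "torque_rate s \<equiv> Im (cnj p * n s)"
abbreviation "curv s \<equiv> q s / lam s"

lemma inner_p: "p \<bullet> w = Re (cnj p * w)" "p \<bullet> w = Re p * Re w + Im p * Im w"
  by (simp_all add: inner_complex_def)

lemma dRe_z: "0 < s \<Longrightarrow> s < L \<Longrightarrow> ((\<lambda>s. Re (z s)) has_real_derivative Re (n s)) (at s)"
  and dIm_z: "0 < s \<Longrightarrow> s < L \<Longrightarrow> ((\<lambda>s. Im (z s)) has_real_derivative Im (n s)) (at s)"
  using dz[of s] bounded_linear.has_vector_derivative[OF bounded_linear_Re]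
    bounded_linear.has_vector_derivative[OF bounded_linear_Im]
  unfolding has_real_derivative_iff_has_vector_derivative by blast+

lemma dRe_n: "0 < s \<Longrightarrow> s < L \<Longrightarrow> ((\<lambda>s. Re (n s)) has_real_derivative - curv s * Im (n s)) (at s)"
  using bounded_linear.has_vector_derivative[OF bounded_linear_Re dn[of s]]
  unfolding has_real_derivative_iff_has_vector_derivative by simp

lemma dIm_n: "0 < s \<Longrightarrow> s < L \<Longrightarrow> ((\<lambda>s. Im (n s)) has_real_derivative curv s * Re (n s)) (at s)"
  using bounded_linear.has_vector_derivative[OF bounded_linear_Im dn[of s]]
  unfolding has_real_derivative_iff_has_vector_derivative by simp

lemma p_nonzero: "p \<noteq> 0"
  using lam_pos[of "L / 2"] L_pos by auto

lemma lam_torque_rate: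
  assumes "0 \<le> s" "s \<le> L" shows "(lam s)\<^sup>2 + (torque_rate s)\<^sup>2 = (cmod p)\<^sup>2"
proof -
  have "(lam s)\<^sup>2 + (torque_rate s)\<^sup>2 = (cmod (cnj p * n s))\<^sup>2"
    by (simp only: cmod_power2 inner_p(1))
  then show ?thesis using norm_n[OF assms] by (simp add: norm_mult)
qed

lemma dtorque_rate:
  assumes "0 < s" "s < L" shows "((\<lambda>s. torque_rate s) has_real_derivative q s) (at s)"
proof -
  have "((\<lambda>s. Re p * Im (n s) - Im p * Re (n s)) has_real_derivative
      Re p * (curv s * Re (n s)) - Im p * (- curv s * Im (n s))) (at s)"
    by (intro DERIV_diff DERIV_cmult dRe_n dIm_n assms)
  moreover have "Re p * (curv s * Re (n s)) - Im p * (- curv s * Im (n s)) = curv s * lam s"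
    by (simp only: inner_p(2)) algebra
  moreover have "curv s * lam s = q s" using lam_pos[OF assms] by simp
  ultimately show ?thesis by (simp add: algebra_simps)
qed

lemma constant_of_zero_derivative:
  fixes f :: "real \<Rightarrow> real"
  assumes "continuous_on {0..L} f" "\<And>s. 0 < s \<Longrightarrow> s < L \<Longrightarrow> (f has_real_derivative 0) (at s)"
    "0 \<le> s" "s \<le> L"
  shows "f s = f 0"
  using DERIV_isconst2[of 0 L f s] L_pos assms by auto

lemma cont_torque_rate: "continuous_on {0..L} (\<lambda>s. torque_rate s)"
  by (intro continuous_intros cont_n)

text \<open>The division by \<open>lam\<close> in the equation for \<open>n\<close> cancels in the
  derivative of \<open>r = torque_rate\<close>, which leaves the linear system
  \<open>q' = r\<close>, \<open>r' = q\<close>. Its conserved quantities are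
  \<open>(q + r) * exp (- s)\<close> and \<open>(q - r) * exp s\<close>.\<close>

lemma q_r_eq:
  assumes s: "0 \<le> s" "s \<le> L"
  shows q_eq: "q s = q 0 * cosh s + torque_rate 0 * sinh s"
    and torque_rate_eq: "torque_rate s = torque_rate 0 * cosh s + q 0 * sinh s"
proof -
  define r where "r = (\<lambda>s. torque_rate s)"
  have dr: "(r has_real_derivative q s) (at s)" if "0 < s" "s < L" for s
    using dtorque_rate that unfolding r_def by simp
  have dq': "(q has_real_derivative r s) (at s)" if "0 < s" "s < L" for s
    using dq that unfolding r_def by simp
  have cr: "continuous_on {0..L} r" using cont_torque_rate unfolding r_def .
  have "(q s + r s) * exp (- s) = (q 0 + r 0) * exp (- 0)"
  proof (rule constant_of_zero_derivative[of "\<lambda>s. (q s + r s) * exp (- s)", OF _ _ s])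
    show "((\<lambda>s. (q s + r s) * exp (- s)) has_real_derivative 0) (at s)" if "0 < s" "s < L" for s
      by (rule derivative_eq_intros dr dq' that refl)+ (simp add: algebra_simps)
  qed (intro continuous_intros cr cont_q)
  then have 1: "q s + r s = (q 0 + r 0) * exp s"
    by (simp add: exp_minus field_simps)
  have "(q s - r s) * exp s = (q 0 - r 0) * exp 0"
  proof (rule constant_of_zero_derivative[of "\<lambda>s. (q s - r s) * exp s", OF _ _ s])
    show "((\<lambda>s. (q s - r s) * exp s) has_real_derivative 0) (at s)" if "0 < s" "s < L" for s
      by (rule derivative_eq_intros dr dq' that refl)+ (simp add: algebra_simps)
  qed (intro continuous_intros cr cont_q)
  then have 2: "q s - r s = (q 0 - r 0) * exp (- s)"
    by (simp add: exp_minus field_simps)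
  have "2 * q s = (q 0 + r 0) * exp s + (q 0 - r 0) * exp (- s)"
    and "2 * r s = (q 0 + r 0) * exp s - (q 0 - r 0) * exp (- s)"
    using 1 2 by linarith+
  then have "q s = q 0 * cosh s + r 0 * sinh s" "r s = r 0 * cosh s + q 0 * sinh s"
    unfolding cosh_def sinh_def by (simp_all add: algebra_simps)
  then show "q s = q 0 * cosh s + torque_rate 0 * sinh s"
    and "torque_rate s = torque_rate 0 * cosh s + q 0 * sinh s"
    unfolding r_def .
qed

lemma q_neg_between:
  assumes "0 \<le> s" "s < t" "t < u" "u \<le> L" "q s < 0" "q u < 0"
  shows "q t < 0"
  using hyperbolic_negative_between[of s t u "q 0" "torque_rate 0"] assms
    q_eq[of s] q_eq[of t] q_eq[of u] by linarith

lemma q_pos_between: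
  assumes "0 \<le> s" "s < t" "t < u" "u \<le> L" "0 < q s" "0 < q u"
  shows "0 < q t"
  using hyperbolic_negative_between[of s t u "- q 0" "- torque_rate 0"] assms
    q_eq[of s] q_eq[of t] q_eq[of u] by linarith

text \<open>Both sides have the derivative \<open>Im (cnj p * n)\<close>: up to a constant the
  torque is the moment of the position. This is what ties the torques to the common end
  points.\<close>

lemma torque_from_position:
  assumes s: "0 \<le> s" "s \<le> L"
  shows "q s - q 0 = Im (cnj p * (z s - z 0))"
proof -
  define f where "f = (\<lambda>s. q s - (Re p * Im (z s) - Im p * Re (z s)))"
  have "f s = f 0"
  proof (rule constant_of_zero_derivative[OF _ _ s])
    show "continuous_on {0..L} f" unfolding f_def by (intro continuous_intros cont_z cont_q)
    show "(f has_real_derivative 0) (at s)" if "0 < s" "s < L" for s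
      unfolding f_def by (rule derivative_eq_intros dq dRe_z dIm_z that refl)+ simp
  qed
  then show ?thesis unfolding f_def by (simp add: algebra_simps)
qed

text \<open>The signed angle from \<open>p\<close> to \<open>n\<close>. Its cosine is
  \<open>lam / cmod p\<close>, which is nonnegative, so \<open>arcsin\<close> recovers the angle
  completely.\<close>

definition turn :: "real \<Rightarrow> real" where
  "turn s = arcsin (torque_rate s / cmod p)"

lemma torque_rate_bound:
  assumes "0 \<le> s" "s \<le> L" shows "- 1 \<le> torque_rate s / cmod p" "torque_rate s / cmod p \<le> 1"
proof -
  have "\<bar>torque_rate s\<bar> \<le> cmod (cnj p * n s)" by (rule abs_Im_le_cmod)
  then have "\<bar>torque_rate s\<bar> \<le> cmod p" using norm_n[OF assms] by (simp add: norm_mult)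
  then show "- 1 \<le> torque_rate s / cmod p" "torque_rate s / cmod p \<le> 1"
    using p_nonzero by (simp_all add: field_simps)
qed

lemma turn_bounds:
  assumes "0 \<le> s" "s \<le> L" shows "- (pi / 2) \<le> turn s" "turn s \<le> pi / 2"
  using arcsin_bounded[OF torque_rate_bound[OF assms]] unfolding turn_def by auto

lemma turn_mono:
  assumes "0 \<le> s" "s \<le> L" "0 \<le> t" "t \<le> L"
  shows "turn s < turn t \<longleftrightarrow> torque_rate s < torque_rate t"
    "turn s \<le> turn t \<longleftrightarrow> torque_rate s \<le> torque_rate t"
proof -
  have "\<bar>torque_rate s / cmod p\<bar> \<le> 1" "\<bar>torque_rate t / cmod p\<bar> \<le> 1"
    using torque_rate_bound[of s] torque_rate_bound[of t] assms by linarith+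
  from arcsin_less_mono[OF this] arcsin_le_mono[OF this]
  show "turn s < turn t \<longleftrightarrow> torque_rate s < torque_rate t"
    "turn s \<le> turn t \<longleftrightarrow> torque_rate s \<le> torque_rate t"
    unfolding turn_def using p_nonzero by (simp_all only: divide_less_cancel divide_le_cancel) auto
qed

lemma cont_turn: "continuous_on {0..L} turn"
  unfolding turn_def
  by (intro continuous_intros cont_torque_rate) (use torque_rate_bound p_nonzero in auto)

lemma n_eq_cis_turn:
  assumes s: "0 \<le> s" "s \<le> L" shows "n s = sgn p * cis (turn s)"
proof -
  have P: "cmod p > 0" using p_nonzero by simp
  have "cos (turn s) = sqrt (1 - (torque_rate s / cmod p)\<^sup>2)"
    unfolding turn_def by (rule cos_arcsin[OF torque_rate_bound[OF s]])
  also have "1 - (torque_rate s / cmod p)\<^sup>2 = (lam s / cmod p)\<^sup>2"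
    using lam_torque_rate[OF s] P by (simp add: field_simps)
  finally have c: "cos (turn s) = lam s / cmod p" using lam_nonneg[OF s] by simp
  have "sin (turn s) = torque_rate s / cmod p"
    unfolding turn_def by (rule sin_arcsin[OF torque_rate_bound[OF s]])
  with c have "cis (turn s) = cnj p * n s / cmod p"
    by (auto simp: complex_eq_iff inner_p(1))
  then have "sgn p * cis (turn s) = (p * cnj p) * n s / (cmod p * cmod p)"
    by (simp add: sgn_eq)
  also have "\<dots> = n s" 
    using P complex_norm_square[of p] by (simp add: power2_eq_square field_simps)
  finally show ?thesis ..
qed

lemma n_rotated: "0 \<le> s \<Longrightarrow> s \<le> L \<Longrightarrow> n s = n 0 * cis (turn s - turn 0)"
  using n_eq_cis_turn[of s] n_eq_cis_turn[of 0] L_pos by (simp add: cis_mult)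

lemma dturn:
  assumes s: "0 < s" "s < L" shows "(turn has_real_derivative curv s) (at s)"
proof -
  have P: "cmod p > 0" using p_nonzero by simp
  define y where "y = torque_rate s / cmod p"
  have e: "1 - y\<^sup>2 = (lam s / cmod p)\<^sup>2"
    using lam_torque_rate[of s] s P unfolding y_def by (simp add: field_simps)
  have "(lam s / cmod p)\<^sup>2 > 0" using lam_pos[OF s] P by simp
  then have "y\<^sup>2 < 1" using e by linarith
  then have y: "-1 < y" "y < 1" using abs_square_less_1[of y] by auto
  have "((\<lambda>s. torque_rate s / cmod p) has_real_derivative q s / cmod p) (at s)"
    by (intro DERIV_cdivide dtorque_rate s)
  then have "((\<lambda>s. arcsin (torque_rate s / cmod p)) has_real_derivative inverse (sqrt (1 - y\<^sup>2)) * (q s / cmod p)) (at s)"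
    by (rule DERIV_chain2[where f = arcsin, rotated]) (use DERIV_arcsin[OF y] in \<open>simp add: y_def\<close>)
  moreover have "inverse (sqrt (1 - y\<^sup>2)) * (q s / cmod p) = curv s"
    unfolding e using lam_pos[OF s] P by (simp add: real_sqrt_divide field_simps)
  ultimately show ?thesis unfolding turn_def[abs_def] by simp
qed

text \<open>Conjugation exchanges left and right turns; it halves the case distinctions
  below.\<close>

lemma reflected: "planar_geodesic L (cnj p) (\<lambda>s. cnj (z s)) (\<lambda>s. cnj (n s)) (\<lambda>s. - q s)"
proof
  have [simp]: "cnj p \<bullet> cnj w = p \<bullet> w" for w by (simp add: inner_complex_def)
  show "continuous_on {0..L} (\<lambda>s. cnj (z s))" "continuous_on {0..L} (\<lambda>s. cnj (n s))"
    "continuous_on {0..L} (\<lambda>s. - q s)"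
    by (intro continuous_intros cont_z cont_n cont_q)+
  fix s
  show "((\<lambda>s. cnj (z s)) has_vector_derivative cnj (n s)) (at s)" if "0 < s" "s < L"
    using bounded_linear.has_vector_derivative[OF bounded_linear_cnj dz[OF that]] .
  show "((\<lambda>s. cnj (n s)) has_vector_derivative \<i> * complex_of_real (- q s / (cnj p \<bullet> cnj (n s))) * cnj (n s)) (at s)"
    if "0 < s" "s < L"
    using bounded_linear.has_vector_derivative[OF bounded_linear_cnj dn[OF that]] by simp
  show "((\<lambda>s. - q s) has_real_derivative Im (cnj (cnj p) * cnj (n s))) (at s)" if "0 < s" "s < L"
    using DERIV_minus[OF dq[OF that]] by (simp add: algebra_simps)
qed (use L_pos norm_n lam_nonneg lam_pos energy in \<open>auto simp: inner_complex_def\<close>)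

text \<open>Rotations keep the orientation and hence \<open>q\<close>. They serve to make a chosen
  direction the real axis.\<close>

lemma rotated:
  assumes u: "cmod u = 1"
  shows "planar_geodesic L (u * p) (\<lambda>s. u * z s) (\<lambda>s. u * n s) q"
proof
  have c: "cnj u * u = 1" using u complex_norm_square[of u] by (simp add: mult.commute)
  have m: "cnj (u * p) * (u * w) = cnj p * w" for w
  proof -
    have "cnj (u * p) * (u * w) = (cnj u * u) * (cnj p * w)" by simp
    then show ?thesis using c by simp
  qed
  note i = inner_mult_unit[OF u]
  show "continuous_on {0..L} (\<lambda>s. u * z s)" "continuous_on {0..L} (\<lambda>s. u * n s)"
    by (intro continuous_intros cont_z cont_n)+
  fix s
  show "((\<lambda>s. u * z s) has_vector_derivative u * n s) (at s)" if "0 < s" "s < L"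
    by (intro derivative_intros dz that)
  show "((\<lambda>s. u * n s) has_vector_derivative \<i> * complex_of_real (q s / ((u * p) \<bullet> (u * n s))) * (u * n s)) (at s)"
    if "0 < s" "s < L"
    using has_vector_derivative_mult_right[OF dn[OF that], of u] by (simp add: i mult.left_commute mult.assoc)
  show "(q has_real_derivative Im (cnj (u * p) * (u * n s))) (at s)" if "0 < s" "s < L"
    unfolding m by (rule dq[OF that])
  show "cmod (u * n s) = 1" if "0 \<le> s" "s \<le> L" using norm_n[OF that] u by (simp add: norm_mult)
  show "0 \<le> (u * p) \<bullet> (u * n s)" "(q s)\<^sup>2 + ((u * p) \<bullet> (u * n s))\<^sup>2 = 1" if "0 \<le> s" "s \<le> L"
    unfolding i using lam_nonneg[OF that] energy[OF that] .
  show "0 < (u * p) \<bullet> (u * n s)" if "0 < s" "s < L"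
    unfolding i using lam_pos[OF that] .
qed (use L_pos cont_q in auto)

end

section \<open>Two planar geodesics over a common axis\<close>

text \<open>Both curves are graphs over the real axis, and the derivative of \<open>h\<close> makes
  their abscissae advance at the same rate. Since \<open>h\<close> maps interior times to interior
  times, the equations at \<open>s\<close> and at \<open>h s\<close> are available together.\<close>

locale matched_geodesics =
  A: planar_geodesic L p z n q + B: planar_geodesic L' p' z' n' q'
  for L p z n q L' p' z' n' q' +
  fixes h :: "real \<Rightarrow> real"
  assumes Re_n: "\<And>s. 0 \<le> s \<Longrightarrow> s \<le> L \<Longrightarrow> 0 < Re (n s)"
    and Re_n': "\<And>s. 0 \<le> s \<Longrightarrow> s \<le> L' \<Longrightarrow> 0 < Re (n' s)"
    and cont_h: "continuous_on {0..L} h"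
    and h_range: "\<And>s. 0 \<le> s \<Longrightarrow> s \<le> L \<Longrightarrow> 0 \<le> h s \<and> h s \<le> L'"
    and h_interior: "\<And>s. 0 < s \<Longrightarrow> s < L \<Longrightarrow> 0 < h s \<and> h s < L'"
    and h_mono: "\<And>s t. 0 \<le> s \<Longrightarrow> s < t \<Longrightarrow> t \<le> L \<Longrightarrow> h s < h t"
    and dh: "\<And>s. 0 < s \<Longrightarrow> s < L \<Longrightarrow> (h has_real_derivative Re (n s) / Re (n' (h s))) (at s)"
begin

definition slope_gap :: "real \<Rightarrow> real" where
  "slope_gap s = Im (n s) / Re (n s) - Im (n' (h s)) / Re (n' (h s))"

definition height_gap :: "real \<Rightarrow> real" where
  "height_gap s = Im (z s) - Im (z' (h s))"

definition slope_gap_deriv :: "real \<Rightarrow> real" where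
  "slope_gap_deriv s = A.curv s / (Re (n s))\<^sup>2 - B.curv (h s) * Re (n s) / (Re (n' (h s))) ^ 3"

text \<open>The numerator of \<open>slope_gap_deriv\<close> once its positive denominator is
  cleared. Unlike the derivative it is continuous up to the ends, where \<open>lam\<close> may
  vanish.\<close>

definition slope_gap_sign :: "real \<Rightarrow> real" where
  "slope_gap_sign s = q s * B.lam (h s) * Re (n' (h s)) ^ 3 - q' (h s) * A.lam s * Re (n s) ^ 3"

lemma h_image: "h ` {0..L} \<subseteq> {0..L'}"
  using h_range by auto

lemma cont_comp: "continuous_on {0..L'} f \<Longrightarrow> continuous_on {0..L} (\<lambda>s. f (h s))"
  by (rule continuous_on_compose2[OF _ cont_h h_image])

lemma cont_slope_gap: "continuous_on {0..L} slope_gap"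
  unfolding slope_gap_def
proof (intro continuous_intros A.cont_n cont_comp[OF B.cont_n] ballI)
  show "Re (n s) \<noteq> 0" if "s \<in> {0..L}" for s using Re_n[of s] that by auto
  show "Re (n' (h s)) \<noteq> 0" if "s \<in> {0..L}" for s using Re_n'[of "h s"] h_range[of s] that by auto
qed

lemma cont_height_gap: "continuous_on {0..L} height_gap"
  unfolding height_gap_def by (intro continuous_intros A.cont_z cont_comp[OF B.cont_z])

lemma cont_slope_gap_sign: "continuous_on {0..L} slope_gap_sign"
  unfolding slope_gap_sign_def
  by (intro continuous_intros A.cont_n A.cont_q cont_comp[OF B.cont_n] cont_comp[OF B.cont_q])

lemma slope_deriv_id:
  fixes N :: complex and k :: real
  assumes "cmod N = 1" "0 < Re N"
  shows "((k * Re N) * Re N - Im N * (- k * Im N)) / (Re N * Re N) = k / (Re N)\<^sup>2"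
proof -
  have "(k * Re N) * Re N - Im N * (- k * Im N) = k * ((Re N)\<^sup>2 + (Im N)\<^sup>2)"
    by (simp add: power2_eq_square algebra_simps)
  also have "\<dots> = k" using assms cmod_power2[of N] by simp
  finally show ?thesis by (simp add: power2_eq_square)
qed

lemma dslope_gap:
  assumes s: "0 < s" "s < L"
  shows "(slope_gap has_real_derivative slope_gap_deriv s) (at s)"
proof -
  have h: "0 < h s" "h s < L'" using h_interior[OF s] by auto
  have N: "0 < Re (n s)" "0 < Re (n' (h s))" using Re_n[of s] Re_n'[of "h s"] s h by auto
  have "((\<lambda>s. Im (n s) / Re (n s)) has_real_derivative A.curv s / (Re (n s))\<^sup>2) (at s)"
    using DERIV_divide[OF A.dIm_n[OF s] A.dRe_n[OF s]] N s
    unfolding slope_deriv_id[OF A.norm_n[OF less_imp_le[OF s(1)] less_imp_le[OF s(2)]] N(1)] by simp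
  moreover have "((\<lambda>s. Im (n' s) / Re (n' s)) has_real_derivative B.curv (h s) / (Re (n' (h s)))\<^sup>2) (at (h s))"
    using DERIV_divide[OF B.dIm_n[OF h] B.dRe_n[OF h]] N h
    unfolding slope_deriv_id[OF B.norm_n[OF less_imp_le[OF h(1)] less_imp_le[OF h(2)]] N(2)] by simp
  ultimately have "(slope_gap has_real_derivative A.curv s / (Re (n s))\<^sup>2
      - B.curv (h s) / (Re (n' (h s)))\<^sup>2 * (Re (n s) / Re (n' (h s)))) (at s)"
    unfolding slope_gap_def by (intro DERIV_diff DERIV_chain2[OF _ dh[OF s]])
  moreover have "B.curv (h s) / (Re (n' (h s)))\<^sup>2 * (Re (n s) / Re (n' (h s)))
      = B.curv (h s) * Re (n s) / Re (n' (h s)) ^ 3"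
    by (simp add: power2_eq_square power3_eq_cube)
  ultimately show ?thesis unfolding slope_gap_deriv_def by (simp only:)
qed

lemma dheight_gap:
  assumes s: "0 < s" "s < L"
  shows "(height_gap has_real_derivative Re (n s) * slope_gap s) (at s)"
proof -
  have h: "0 < h s" "h s < L'" using h_interior[OF s] by auto
  have N: "0 < Re (n s)" "0 < Re (n' (h s))" using Re_n[of s] Re_n'[of "h s"] s h by auto
  have "(height_gap has_real_derivative Im (n s) - Im (n' (h s)) * (Re (n s) / Re (n' (h s)))) (at s)"
    unfolding height_gap_def by (intro DERIV_diff A.dIm_z s DERIV_chain2[OF B.dIm_z[OF h] dh[OF s]])
  moreover have "Im (n s) - Im (n' (h s)) * (Re (n s) / Re (n' (h s))) = Re (n s) * slope_gap s"
    using N unfolding slope_gap_def by (simp add: field_simps)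
  ultimately show ?thesis by simp
qed

lemma slope_gap_deriv_eq:
  assumes s: "0 < s" "s < L"
  shows "slope_gap_deriv s * (A.lam s * B.lam (h s) * (Re (n s))\<^sup>2 * Re (n' (h s)) ^ 3) = slope_gap_sign s"
    and "0 < A.lam s * B.lam (h s) * (Re (n s))\<^sup>2 * Re (n' (h s)) ^ 3"
proof -
  have h: "0 < h s" "h s < L'" using h_interior[OF s] by auto
  have N: "0 < Re (n s)" "0 < Re (n' (h s))" using Re_n[of s] Re_n'[of "h s"] s h by auto
  define a b c d where "a = A.lam s" "b = B.lam (h s)" "c = Re (n s)" "d = Re (n' (h s))"
  note abcd = this
  have pos: "0 < a" "0 < b" "0 < c" "0 < d"
    using A.lam_pos[OF s] B.lam_pos[OF h] N unfolding abcd .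
  then show "0 < A.lam s * B.lam (h s) * (Re (n s))\<^sup>2 * Re (n' (h s)) ^ 3"
    unfolding abcd[symmetric] by simp
  have "(q s / a / c\<^sup>2 - q' (h s) / b * c / d ^ 3) * (a * b * c\<^sup>2 * d ^ 3) = q s * b * d ^ 3 - q' (h s) * a * c ^ 3"
    using pos by (simp add: field_simps power2_eq_square power3_eq_cube)
  then show "slope_gap_deriv s * (A.lam s * B.lam (h s) * (Re (n s))\<^sup>2 * Re (n' (h s)) ^ 3) = slope_gap_sign s"
    unfolding slope_gap_deriv_def slope_gap_sign_def abcd .
qed

lemma slope_gap_zero: "0 \<le> s \<Longrightarrow> s \<le> L \<Longrightarrow> slope_gap s = 0 \<Longrightarrow> n s = n' (h s)"
  unfolding slope_gap_def
  using unit_complex_eq_of_slope_eq[of "n s" "n' (h s)"] A.norm_n B.norm_n Re_n Re_n' h_range by auto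

text \<open>Equal slopes mean equal directions, so the powers of \<open>Re n\<close> in
  \<open>slope_gap_sign\<close> agree at \<open>s0\<close> and the sign is that of
  \<open>q * lam' - q' * lam\<close>. Both pairs of torque and \<open>lam\<close> are unit vectors
  by the energy identity, so this sign follows from \<open>q' < q\<close>.\<close>

lemma slope_gap_deriv_pos_near:
  assumes s0: "0 \<le> s0" "s0 \<le> L" and gap: "slope_gap s0 = 0" and less: "q' (h s0) < q s0"
  obtains e where "0 < e" "\<And>s. 0 < s \<Longrightarrow> s < L \<Longrightarrow> \<bar>s - s0\<bar> < e \<Longrightarrow> 0 < slope_gap_deriv s"
proof -
  have reduce: "0 < slope_gap_deriv s" if "0 < slope_gap_sign s" "0 < s" "s < L" for s
    using slope_gap_deriv_eq[of s] that by (metis zero_less_mult_pos2)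
  show ?thesis
  proof (cases "0 < q s0 \<and> q' (h s0) < 0")
    \<comment> \<open>With torques of opposite sign, \<open>slope_gap_sign s0\<close> is 0 if both
      curves have a cusp there. The sign is therefore read at interior points near
      \<open>s0\<close>, where both values of \<open>lam\<close> are positive.\<close>
    case True
    obtain e1 where e1: "0 < e1" "\<And>s. s \<in> {0..L} \<Longrightarrow> \<bar>s - s0\<bar> < e1 \<Longrightarrow> 0 < q s"
      using eventually_positive_near[OF A.cont_q, of s0] True s0 by auto
    obtain e2 where e2: "0 < e2" "\<And>s. s \<in> {0..L} \<Longrightarrow> \<bar>s - s0\<bar> < e2 \<Longrightarrow> 0 < - q' (h s)"
      using eventually_positive_near[OF continuous_on_minus[OF cont_comp[OF B.cont_q]], of s0] True s0 by auto
    show ?thesis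
    proof (rule that[of "min e1 e2"])
      fix s assume s: "0 < s" "s < L" "\<bar>s - s0\<bar> < min e1 e2"
      have h: "0 < h s" "h s < L'" using h_interior s by auto
      have "0 < q s * B.lam (h s) * Re (n' (h s)) ^ 3"
        using e1(2)[of s] s B.lam_pos[OF h] Re_n'[of "h s"] h by simp
      moreover have "q' (h s) * A.lam s * Re (n s) ^ 3 < 0"
        using e2(2)[of s] s A.lam_pos[of s] Re_n[of s] by (simp add: mult_neg_pos)
      ultimately show "0 < slope_gap_deriv s"
        using reduce s unfolding slope_gap_sign_def by auto
    qed (use e1 e2 in auto)
  next
    case False
    have h: "0 \<le> h s0" "h s0 \<le> L'" using h_range s0 by auto
    have "q' (h s0) * A.lam s0 < q s0 * B.lam (h s0)"
      by (rule unit_pair_cross_mono) (use A.energy B.energy A.lam_nonneg B.lam_nonneg s0 h less False in auto)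
    then have "q' (h s0) * A.lam s0 * Re (n s0) ^ 3 < q s0 * B.lam (h s0) * Re (n s0) ^ 3"
      using Re_n[OF s0] by (simp add: mult_strict_right_mono)
    then have "0 < slope_gap_sign s0"
      unfolding slope_gap_sign_def slope_gap_zero[OF s0 gap, symmetric] by simp
    then obtain e where "0 < e" "\<And>s. s \<in> {0..L} \<Longrightarrow> \<bar>s - s0\<bar> < e \<Longrightarrow> 0 < slope_gap_sign s"
      using eventually_positive_near[OF cont_slope_gap_sign, of s0] s0 by auto
    then show ?thesis using that[of e] reduce by auto
  qed
qed

lemma reflected: "matched_geodesics L (cnj p) (\<lambda>s. cnj (z s)) (\<lambda>s. cnj (n s)) (\<lambda>s. - q s)
   L' (cnj p') (\<lambda>s. cnj (z' s)) (\<lambda>s. cnj (n' s)) (\<lambda>s. - q' s) h"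
  unfolding matched_geodesics_def matched_geodesics_axioms_def
  using A.reflected B.reflected Re_n Re_n' cont_h h_range h_interior h_mono dh by auto

end

context matched_geodesics
begin

interpretation R: matched_geodesics L "cnj p" "\<lambda>s. cnj (z s)" "\<lambda>s. cnj (n s)" "\<lambda>s. - q s"
   L' "cnj p'" "\<lambda>s. cnj (z' s)" "\<lambda>s. cnj (n' s)" "\<lambda>s. - q' s" h
  by (rule reflected)

lemma reflected_gaps: "R.slope_gap s = - slope_gap s" "R.height_gap s = - height_gap s"
    "R.slope_gap_deriv s = - slope_gap_deriv s"
  unfolding slope_gap_def R.slope_gap_def height_gap_def R.height_gap_def
    slope_gap_deriv_def R.slope_gap_deriv_def by (simp_all add: inner_complex_def)

lemma slope_gap_deriv_neg_near:
  assumes s0: "0 \<le> s0" "s0 \<le> L" and gap: "slope_gap s0 = 0" and less: "q s0 < q' (h s0)"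
  obtains e where "0 < e" "\<And>s. 0 < s \<Longrightarrow> s < L \<Longrightarrow> \<bar>s - s0\<bar> < e \<Longrightarrow> slope_gap_deriv s < 0"
  using R.slope_gap_deriv_pos_near[OF s0] gap less unfolding reflected_gaps by auto

text \<open>If the torques at an end of the interval were ordered the other way, strictly, the slope
  gap would have the wrong monotonicity there and would be positive somewhere inside. The height gap
  falls because its derivative is the slope gap times \<open>Re n\<close>.\<close>

lemma below_interval:
  assumes cd: "0 \<le> c" "c < d" "d \<le> L" and zero: "slope_gap c = 0" "slope_gap d = 0"
    and neg: "\<And>s. c < s \<Longrightarrow> s < d \<Longrightarrow> slope_gap s < 0"
  shows "q c \<le> q' (h c)" "q' (h d) \<le> q d" "height_gap d < height_gap c"
proof -
  have cont: "continuous_on {c..d} slope_gap"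
    using continuous_on_subset[OF cont_slope_gap] cd by auto
  show "q c \<le> q' (h c)"
  proof (rule ccontr)
    assume "\<not> q c \<le> q' (h c)"
    then obtain e where e: "0 < e" "\<And>s. 0 < s \<Longrightarrow> s < L \<Longrightarrow> \<bar>s - c\<bar> < e \<Longrightarrow> 0 < slope_gap_deriv s"
      using slope_gap_deriv_pos_near[of c] cd zero by auto
    have "\<exists>s. c < s \<and> s < d \<and> 0 < slope_gap s"
      by (rule positive_right_of_zero[OF cd(2) cont zero(1) dslope_gap e(1) e(2)]) (use cd in auto)
    then show False using neg by force
  qed
  show "q' (h d) \<le> q d"
  proof (rule ccontr)
    assume "\<not> q' (h d) \<le> q d"
    then obtain e where e: "0 < e" "\<And>s. 0 < s \<Longrightarrow> s < L \<Longrightarrow> \<bar>s - d\<bar> < e \<Longrightarrow> slope_gap_deriv s < 0"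
      using slope_gap_deriv_neg_near[of d] cd zero by auto
    have "\<exists>s. c < s \<and> s < d \<and> 0 < slope_gap s"
      by (rule positive_left_of_zero[OF cd(2) cont zero(2) dslope_gap e(1) e(2)]) (use cd in auto)
    then show False using neg by force
  qed
  show "height_gap d < height_gap c"
  proof (rule decreasing_from_derivative[OF cd(2) _ dheight_gap])
    show "continuous_on {c..d} height_gap" using continuous_on_subset[OF cont_height_gap] cd by auto
    show "Re (n s) * slope_gap s < 0" if "c < s" "s < d" for s
      using neg[OF that] Re_n[of s] that cd by (simp add: mult_pos_neg)
  qed (use cd in auto)
qed

end

context matched_geodesics
begin

interpretation R: matched_geodesics L "cnj p" "\<lambda>s. cnj (z s)" "\<lambda>s. cnj (n s)" "\<lambda>s. - q s"
   L' "cnj p'" "\<lambda>s. cnj (z' s)" "\<lambda>s. cnj (n' s)" "\<lambda>s. - q' s" h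
  by (rule reflected)

lemma above_interval:
  assumes "0 \<le> c" "c < d" "d \<le> L" "slope_gap c = 0" "slope_gap d = 0"
    and "\<And>s. c < s \<Longrightarrow> s < d \<Longrightarrow> 0 < slope_gap s"
  shows "q' (h c) \<le> q c" "q d \<le> q' (h d)" "height_gap c < height_gap d"
  using R.below_interval[of c d] assms
  unfolding R.slope_gap_def slope_gap_def R.height_gap_def height_gap_def by auto

text \<open>The height gap grows at the rate \<open>Re n * slope_gap\<close> with
  \<open>Re n > 0\<close>; equal values at the two ends leave no room for an interval of positive
  slope gap.\<close>

lemma slope_gap_nonneg_imp_zero:
  assumes "slope_gap 0 = 0" "slope_gap L = 0" "height_gap 0 = height_gap L"
    and nonneg: "\<And>s. 0 \<le> s \<Longrightarrow> s \<le> L \<Longrightarrow> 0 \<le> slope_gap s" and s: "0 \<le> s" "s \<le> L"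
  shows "slope_gap s = 0"
proof (rule ccontr)
  assume "slope_gap s \<noteq> 0"
  then have "- slope_gap s < 0" using nonneg[OF s] by simp
  then obtain c d where cd: "0 \<le> c" "c < s" "s < d" "d \<le> L" "slope_gap c = 0" "slope_gap d = 0"
      "\<And>t. c < t \<Longrightarrow> t < d \<Longrightarrow> - slope_gap t < 0"
    using negative_component[of 0 L "\<lambda>s. - slope_gap s" s] assms continuous_on_minus[OF cont_slope_gap] by auto
  have mono: "height_gap u \<le> height_gap v" if "0 \<le> u" "u \<le> v" "v \<le> L" for u v
  proof (rule DERIV_nonneg_imp_increasing_open[OF that(2)])
    fix x assume x: "u < x" "x < v"
    then have "0 \<le> Re (n x) * slope_gap x" using Re_n[of x] nonneg[of x] that by simp
    then show "\<exists>y. (height_gap has_real_derivative y) (at x) \<and> 0 \<le> y"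
      using dheight_gap[of x] that x by auto
  qed (use continuous_on_subset[OF cont_height_gap] that in auto)
  have "height_gap c < height_gap d" using above_interval[of c d] cd by auto
  then show False using mono[of 0 c] mono[of d L] cd assms(3) by auto
qed

text \<open>The difference of \<open>torque_from_position\<close> for the two curves over the same
  piece of the axis. With equal axial momenta, the abscissae enter only through the difference of
  the transverse momenta.\<close>

lemma height_gap_rate:
  assumes "Re (z' (h c)) = Re (z c)" "Re (z' (h d)) = Re (z d)" "0 \<le> c" "c \<le> L" "0 \<le> d" "d \<le> L" "Re p = Re p'"
  shows "(q d - q' (h d)) - (q c - q' (h c))
    = Re p * (height_gap d - height_gap c) - (Im p - Im p') * (Re (z d) - Re (z c))"
proof -
  have "q d - q c = Im (cnj p * (z d - z c))"
    using A.torque_from_position[of c] A.torque_from_position[of d] assms by (simp add: algebra_simps)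
  moreover have "q' (h d) - q' (h c) = Im (cnj p' * (z' (h d) - z' (h c)))"
    using B.torque_from_position[of "h c"] B.torque_from_position[of "h d"] assms h_range[of c] h_range[of d]
    by (simp add: algebra_simps)
  ultimately show ?thesis using assms unfolding height_gap_def by (simp add: algebra_simps)
qed

end

section \<open>Comparison of two graphs with common end data\<close>

locale linked_geodesics = matched_geodesics +
  assumes h_ends: "h 0 = 0" "h L = L'"
    and h_Re: "\<And>s. 0 \<le> s \<Longrightarrow> s \<le> L \<Longrightarrow> Re (z' (h s)) = Re (z s)"
    and z_ends: "z 0 = z' 0" "z L = z' L'"
    and n_ends: "n 0 = n' 0" "n L = n' L'"
begin

abbreviation coincide :: bool where
  "coincide \<equiv> L = L' \<and> (\<forall>s\<in>{0..L}. z s = z' s)"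

lemma gaps_at_ends: "slope_gap 0 = 0" "slope_gap L = 0" "height_gap 0 = 0" "height_gap L = 0"
  unfolding slope_gap_def height_gap_def using h_ends z_ends n_ends by auto

lemma reflected: "linked_geodesics L (cnj p) (\<lambda>s. cnj (z s)) (\<lambda>s. cnj (n s)) (\<lambda>s. - q s)
   L' (cnj p') (\<lambda>s. cnj (z' s)) (\<lambda>s. cnj (n' s)) (\<lambda>s. - q' s) h"
  unfolding linked_geodesics_def linked_geodesics_axioms_def
  using reflected h_ends h_Re z_ends n_ends by auto

text \<open>Equal directions give \<open>h\<close> the derivative 1, so \<open>h\<close> is the
  identity and the heights agree as well.\<close>

lemma coincide_if_no_slope_gap:
  assumes "\<And>s. 0 \<le> s \<Longrightarrow> s \<le> L \<Longrightarrow> slope_gap s = 0"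
  shows coincide
proof -
  have n: "n s = n' (h s)" if "0 \<le> s" "s \<le> L" for s
    using slope_gap_zero assms that by auto
  have h: "h s = s" if s: "0 \<le> s" "s \<le> L" for s
  proof -
    have "h s - s = h 0 - 0"
    proof (rule A.constant_of_zero_derivative[of "\<lambda>s. h s - s", OF _ _ s])
      show "((\<lambda>s. h s - s) has_real_derivative 0) (at s)" if "0 < s" "s < L" for s
      proof -
        have "Re (n' (h s)) \<noteq> 0" using n[of s] Re_n[of s] that by auto
        then show ?thesis using DERIV_diff[OF dh[OF that] DERIV_ident] n[of s] that by simp
      qed
    qed (intro continuous_intros cont_h)
    then show ?thesis using h_ends by simp
  qed
  have L: "L = L'" using h[of L] h_ends A.L_pos by simp
  have "z s = z' s" if s: "0 \<le> s" "s \<le> L" for s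
  proof -
    have "Re (z s) = Re (z' s)" using h_Re[OF s] h[OF s] by simp
    moreover have "height_gap s = height_gap 0"
    proof (rule A.constant_of_zero_derivative[OF cont_height_gap _ s])
      show "(height_gap has_real_derivative 0) (at s)" if "0 < s" "s < L" for s
        using dheight_gap[OF that] assms[of s] that by simp
    qed
    ultimately show ?thesis using h[OF s] gaps_at_ends unfolding height_gap_def by (simp add: complex_eq_iff)
  qed
  with L show ?thesis by auto
qed

lemma slope_gap_negative_somewhere:
  assumes "\<not> coincide" obtains s where "0 \<le> s" "s \<le> L" "slope_gap s < 0"
  using slope_gap_nonneg_imp_zero gaps_at_ends coincide_if_no_slope_gap assms by (metis not_less)

lemma negative_interval:
  assumes "\<not> coincide"
  obtains c d where "0 \<le> c" "c < d" "d \<le> L" "slope_gap c = 0" "slope_gap d = 0"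
    "\<And>s. c < s \<Longrightarrow> s < d \<Longrightarrow> slope_gap s < 0"
proof -
  obtain s where s: "0 \<le> s" "s \<le> L" "slope_gap s < 0"
    using slope_gap_negative_somewhere[OF assms] .
  show ?thesis
  proof (rule negative_component[OF cont_slope_gap gaps_at_ends(1,2) _ s(3)])
    fix c d assume cd: "0 \<le> c" "c < s" "s < d" "d \<le> L" "slope_gap c = 0" "slope_gap d = 0"
      "\<And>t. c < t \<Longrightarrow> t < d \<Longrightarrow> slope_gap t < 0"
    show thesis by (rule that[OF cd(1) less_trans[OF cd(2,3)] cd(4-7)])
  qed (use s in auto)
qed

end

context linked_geodesics
begin

interpretation R: linked_geodesics L "cnj p" "\<lambda>s. cnj (z s)" "\<lambda>s. cnj (n s)" "\<lambda>s. - q s"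
   L' "cnj p'" "\<lambda>s. cnj (z' s)" "\<lambda>s. cnj (n' s)" "\<lambda>s. - q' s" h
  by (rule reflected)

lemma positive_interval:
  assumes "\<not> coincide"
  obtains c d where "0 \<le> c" "c < d" "d \<le> L" "slope_gap c = 0" "slope_gap d = 0"
    "\<And>s. c < s \<Longrightarrow> s < d \<Longrightarrow> 0 < slope_gap s"
proof -
  have "\<not> (L = L' \<and> (\<forall>s\<in>{0..L}. cnj (z s) = cnj (z' s)))" using assms by simp
  then show ?thesis
  proof (rule R.negative_interval)
    fix c d assume cd: "0 \<le> c" "c < d" "d \<le> L" "R.slope_gap c = 0" "R.slope_gap d = 0"
      "\<And>s. c < s \<Longrightarrow> s < d \<Longrightarrow> R.slope_gap s < 0"
    show thesis
      by (rule that[OF cd(1-3)]) (use cd(4-6) in \<open>auto simp: R.slope_gap_def slope_gap_def\<close>)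
  qed
qed

text \<open>Over an interval of negative slope gap, \<open>below_interval\<close> makes
  \<open>q - q'\<close> rise from a nonpositive to a nonnegative value. By
  \<open>height_gap_rate\<close> the rise is \<open>Re p\<close> times a negative height change,
  minus \<open>Im p - Im p'\<close> times a positive displacement. If
  \<open>Im p' \<le> Im p\<close>, both contributions are nonpositive, and the last hypothesis makes
  one of them strict. If \<open>Im p < Im p'\<close>, an interval of positive slope gap yields the
  same contradiction.\<close>

lemma coincide_if_equal_axial_momentum:
  assumes P: "Re p = Re p'" "0 \<le> Re p" "Im p \<noteq> Im p' \<or> 0 < Re p"
  shows coincide
proof (rule ccontr)
  assume neq: "\<not> coincide"
  have Re_mono: "Re (z c) < Re (z d)" if "0 \<le> c" "c < d" "d \<le> L" for c d
    by (rule increasing_from_derivative[OF that(2) _ A.dRe_z Re_n])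
      (use that continuous_on_subset[OF A.cont_z, of "{c..d}"] in \<open>auto intro!: continuous_intros\<close>)
  show False
  proof (cases "Im p' \<le> Im p")
    case True
    obtain c d where cd: "0 \<le> c" "c < d" "d \<le> L" "slope_gap c = 0" "slope_gap d = 0"
      "\<And>s. c < s \<Longrightarrow> s < d \<Longrightarrow> slope_gap s < 0"
      using negative_interval[OF neq] by blast
    note below = below_interval[OF cd]
    have "(q d - q' (h d)) - (q c - q' (h c))
        = Re p * (height_gap d - height_gap c) - (Im p - Im p') * (Re (z d) - Re (z c))"
      by (rule height_gap_rate) (use h_Re cd(1-3) P in auto)
    moreover have "Re p * (height_gap d - height_gap c) \<le> 0" "Re p > 0 \<Longrightarrow> Re p * (height_gap d - height_gap c) < 0"
      using below(3) P(2) by (simp_all add: mult_nonneg_nonpos mult_pos_neg)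
    moreover have "0 \<le> (Im p - Im p') * (Re (z d) - Re (z c))"
      "Im p \<noteq> Im p' \<Longrightarrow> 0 < (Im p - Im p') * (Re (z d) - Re (z c))"
      using Re_mono[OF cd(1-3)] True by simp_all
    ultimately show False using below(1,2) P(3) by linarith
  next
    case False
    obtain c d where cd: "0 \<le> c" "c < d" "d \<le> L" "slope_gap c = 0" "slope_gap d = 0"
      "\<And>s. c < s \<Longrightarrow> s < d \<Longrightarrow> 0 < slope_gap s"
      using positive_interval[OF neq] by blast
    note above = above_interval[OF cd]
    have "(q d - q' (h d)) - (q c - q' (h c))
        = Re p * (height_gap d - height_gap c) - (Im p - Im p') * (Re (z d) - Re (z c))"
      by (rule height_gap_rate) (use h_Re cd(1-3) P in auto)
    moreover have "0 \<le> Re p * (height_gap d - height_gap c)"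
      using above(3) P(2) by simp
    moreover have "(Im p - Im p') * (Re (z d) - Re (z c)) < 0"
      using Re_mono[OF cd(1-3)] False by (simp add: mult_neg_pos)
    ultimately show False using above(1,2) by linarith
  qed
qed

text \<open>Where the directions agree, the energy identity turns the sign of \<open>(p - p') \<bullet> n\<close> into a
  comparison of \<open>\<bar>q\<bar>\<close> and \<open>\<bar>q'\<bar>\<close>; the larger one would have to change sign twice.\<close>

lemma coincide_if_momentum_dominates:
  assumes dom: "(\<forall>s\<in>{0..L}. 0 < (p - p') \<bullet> n s) \<or> (\<forall>s\<in>{0..L}. (p - p') \<bullet> n s < 0)"
  shows coincide
proof (rule ccontr)
  assume neq: "\<not> coincide"
  obtain c d where cd: "0 \<le> c" "c < d" "d \<le> L" "slope_gap c = 0" "slope_gap d = 0"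
    "\<And>s. c < s \<Longrightarrow> s < d \<Longrightarrow> slope_gap s < 0"
    using negative_interval[OF neq] by blast
  obtain a b where ab: "0 \<le> a" "a < b" "b \<le> L" "slope_gap a = 0" "slope_gap b = 0"
    "\<And>s. a < s \<Longrightarrow> s < b \<Longrightarrow> 0 < slope_gap s"
    using positive_interval[OF neq] by blast
  have disj: "b \<le> c \<or> d \<le> a"
  proof (rule ccontr)
    assume "\<not> (b \<le> c \<or> d \<le> a)"
    then have "max a c < min b d" using ab(1-3) cd(1-3) by auto
    then obtain s where "max a c < s" "s < min b d" using dense by blast
    then show False using ab(6)[of s] cd(6)[of s] by auto
  qed
  have ra: "0 \<le> a" "a \<le> L" and rb: "0 \<le> b" "b \<le> L" and rc: "0 \<le> c" "c \<le> L" and rd: "0 \<le> d" "d \<le> L"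
    using ab(1-3) cd(1-3) by auto
  note below = below_interval[OF cd] and above = above_interval[OF ab]
  have hab: "0 \<le> h a" "h a < h b" "h b \<le> L'" and hcd: "0 \<le> h c" "h c < h d" "h d \<le> L'"
    using h_range[of a] h_range[of b] h_range[of c] h_range[of d] h_mono[OF ab(1-3)] h_mono[OF cd(1-3)]
      ab(1-3) cd(1-3) by linarith+
  have energy: "(q s)\<^sup>2 + (A.lam s)\<^sup>2 = (q' (h s))\<^sup>2 + (B.lam (h s))\<^sup>2" "0 \<le> A.lam s" "0 \<le> B.lam (h s)"
    "A.lam s - B.lam (h s) = (p - p') \<bullet> n s" if "0 \<le> s" "s \<le> L" "slope_gap s = 0" for s
    using A.energy[OF that(1,2)] B.energy[of "h s"] A.lam_nonneg[OF that(1,2)] B.lam_nonneg[of "h s"]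
      h_range[OF that(1,2)] slope_gap_zero[OF that] by (simp_all add: inner_diff_left)
  from dom show False
  proof
    assume dom: "\<forall>s\<in>{0..L}. 0 < (p - p') \<bullet> n s"
    have lt: "\<bar>q s\<bar> < \<bar>q' (h s)\<bar>" if "0 \<le> s" "s \<le> L" "slope_gap s = 0" for s
    proof -
      have "B.lam (h s) < A.lam s" using energy(4)[OF that] bspec[OF dom, of s] that(1,2) by auto
      then have "(B.lam (h s))\<^sup>2 < (A.lam s)\<^sup>2" using energy(3)[OF that] by (simp add: power_strict_mono)
      then have "(q s)\<^sup>2 < (q' (h s))\<^sup>2" using energy(1)[OF that] by linarith
      then show ?thesis using abs_le_square_iff[of "q' (h s)" "q s"] by linarith
    qed
    \<comment> \<open>An inequality between \<open>q\<close> and \<open>q'\<close> together with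
      \<open>\<bar>q\<bar> < \<bar>q'\<bar>\<close> fixes the sign of \<open>q'\<close>. In the
      order of time the signs of \<open>q'\<close> read \<open>-, +, +, -\<close> or
      \<open>+, -, -, +\<close>, according to which interval comes first.\<close>
    have signs: "q' (h a) < 0" "0 < q' (h b)" "0 < q' (h c)" "q' (h d) < 0"
      using lt[OF ra ab(4)] lt[OF rb ab(5)] lt[OF rc cd(4)] lt[OF rd cd(5)] below(1,2) above(1,2) by arith+
    from disj show False
    proof
      assume "b \<le> c"
      then have "h b < h d" using h_mono[of b d] ab(1-3) cd(1-3) by linarith
      then show False using B.q_neg_between[of "h a" "h b" "h d"] signs hab hcd by linarith
    next
      assume "d \<le> a"
      then have "h d < h b" using h_mono[of d b] ab(1-3) cd(1-3) by linarith
      then show False using B.q_pos_between[of "h c" "h d" "h b"] signs hab hcd by linarith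
    qed
  next
    assume dom: "\<forall>s\<in>{0..L}. (p - p') \<bullet> n s < 0"
    have lt: "\<bar>q' (h s)\<bar> < \<bar>q s\<bar>" if "0 \<le> s" "s \<le> L" "slope_gap s = 0" for s
    proof -
      have "A.lam s < B.lam (h s)" using energy(4)[OF that] bspec[OF dom, of s] that(1,2) by auto
      then have "(A.lam s)\<^sup>2 < (B.lam (h s))\<^sup>2" using energy(2)[OF that] by (simp add: power_strict_mono)
      then have "(q' (h s))\<^sup>2 < (q s)\<^sup>2" using energy(1)[OF that] by linarith
      then show ?thesis using abs_le_square_iff[of "q s" "q' (h s)"] by linarith
    qed
    have signs: "0 < q a" "q b < 0" "q c < 0" "0 < q d"
      using lt[OF ra ab(4)] lt[OF rb ab(5)] lt[OF rc cd(4)] lt[OF rd cd(5)] below(1,2) above(1,2) by arith+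
    from disj show False
    proof
      assume "b \<le> c"
      then show False using A.q_pos_between[of a b d] signs ab(1-3) cd(1-3) by linarith
    next
      assume "d \<le> a"
      then show False using A.q_neg_between[of c d b] signs ab(1-3) cd(1-3) by linarith
    qed
  qed
qed

text \<open>On an interval \<open>a\<close>, \<open>b\<close> of positive slope gap the torques
  would satisfy \<open>q' (h a) \<le> q a \<le> q b \<le> q' (h b)\<close>, against the strict
  decrease of \<open>q'\<close>.\<close>

lemma coincide_if_opposite_monotone:
  assumes "\<And>s t. 0 \<le> s \<Longrightarrow> s < t \<Longrightarrow> t \<le> L \<Longrightarrow> q s \<le> q t"
    and "\<And>s t. 0 \<le> s \<Longrightarrow> s < t \<Longrightarrow> t \<le> L' \<Longrightarrow> q' t < q' s"
  shows coincide
proof (rule ccontr)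
  assume neq: "\<not> coincide"
  obtain a b where ab: "0 \<le> a" "a < b" "b \<le> L" "slope_gap a = 0" "slope_gap b = 0"
    "\<And>s. a < s \<Longrightarrow> s < b \<Longrightarrow> 0 < slope_gap s"
    using positive_interval[OF neq] by blast
  show False
    using above_interval(1,2)[OF ab] assms(1)[OF ab(1-3)] assms(2)[of "h a" "h b"]
      h_range[of a] h_range[of b] h_mono[OF ab(1-3)] ab(1-3) by linarith
qed

end

section \<open>Choice of the common axis\<close>

lemma linked_geodesics_exists:
  assumes A: "planar_geodesic L p z n q" and B: "planar_geodesic L' p' z' n' q'"
    and ends: "z 0 = z' 0" "z L = z' L'" "n 0 = n' 0" "n L = n' L'"
    and pos: "\<And>s. 0 \<le> s \<Longrightarrow> s \<le> L \<Longrightarrow> 0 < Re (n s)" "\<And>s. 0 \<le> s \<Longrightarrow> s \<le> L' \<Longrightarrow> 0 < Re (n' s)"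
  obtains h where "linked_geodesics L p z n q L' p' z' n' q' h"
proof -
  interpret A: planar_geodesic L p z n q by (rule A)
  interpret B: planar_geodesic L' p' z' n' q' by (rule B)
  show ?thesis
  proof (rule increasing_reparametrization[of L L' "\<lambda>s. Re (z s)" "\<lambda>s. Re (z' s)" "\<lambda>s. Re (n s)" "\<lambda>s. Re (n' s)"])
    fix h assume h: "continuous_on {0..L} h" "h 0 = 0" "h L = L'"
      "\<And>s. 0 \<le> s \<Longrightarrow> s \<le> L \<Longrightarrow> Re (z' (h s)) = Re (z s)"
      "\<And>s t. 0 \<le> s \<Longrightarrow> s < t \<Longrightarrow> t \<le> L \<Longrightarrow> h s < h t"
      "\<And>s. 0 \<le> s \<Longrightarrow> s \<le> L \<Longrightarrow> 0 \<le> h s \<and> h s \<le> L'"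
      "\<And>s. 0 < s \<Longrightarrow> s < L \<Longrightarrow> 0 < h s \<and> h s < L'"
      "\<And>s. 0 < s \<Longrightarrow> s < L \<Longrightarrow> (h has_real_derivative Re (n s) / Re (n' (h s))) (at s)"
    have "linked_geodesics L p z n q L' p' z' n' q' h"
      by (rule linked_geodesics.intro[OF matched_geodesics.intro[OF A B matched_geodesics_axioms.intro]
            linked_geodesics_axioms.intro]) (fact h pos ends)+
    then show thesis by (rule that)
  next
    show "continuous_on {0..L} (\<lambda>s. Re (z s))" "continuous_on {0..L'} (\<lambda>s. Re (z' s))"
      by (intro continuous_intros A.cont_z B.cont_z)+
    show "0 < Re (n s)" if "0 < s" "s < L" for s using pos(1)[of s] that by simp
    show "0 < Re (n' s)" if "0 < s" "s < L'" for s using pos(2)[of s] that by simp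
  qed (fact A.L_pos B.L_pos A.dRe_z B.dRe_z | simp only: ends)+
qed

lemma continuous_nonzero_same_sign:
  fixes f :: "real \<Rightarrow> real"
  assumes cont: "continuous_on S f" and "connected S" and nz: "\<And>s. s \<in> S \<Longrightarrow> f s \<noteq> 0"
  shows "(\<forall>s\<in>S. 0 < f s) \<or> (\<forall>s\<in>S. f s < 0)"
proof (rule ccontr)
  assume "\<not> ?thesis"
  then obtain s t where "s \<in> S" "t \<in> S" "f s \<le> 0" "0 \<le> f t" by (auto simp: not_less)
  then have "0 \<in> f ` S"
    using connectedD_interval[OF connected_continuous_image[OF assms(1,2)], of "f s" "f t" 0] by auto
  then show False using nz by auto
qed

text \<open>Multiplication by \<open>cnj m\<close> carries the unit vector \<open>m\<close> to 1,
  and \<open>m \<bullet> w\<close> becomes the real part.\<close>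

lemma linked_geodesics_over_axis:
  assumes A: "planar_geodesic L p z n q" and B: "planar_geodesic L' p' z' n' q'"
    and ends: "z 0 = z' 0" "z L = z' L'" "n 0 = n' 0" "n L = n' L'"
    and m: "cmod m = 1" "\<And>s. 0 \<le> s \<Longrightarrow> s \<le> L \<Longrightarrow> 0 < m \<bullet> n s" "\<And>s. 0 \<le> s \<Longrightarrow> s \<le> L' \<Longrightarrow> 0 < m \<bullet> n' s"
  obtains h where "linked_geodesics L (cnj m * p) (\<lambda>s. cnj m * z s) (\<lambda>s. cnj m * n s) q
    L' (cnj m * p') (\<lambda>s. cnj m * z' s) (\<lambda>s. cnj m * n' s) q' h"
proof -
  have u: "cmod (cnj m) = 1" using m by simp
  have i: "Re (cnj m * w) = m \<bullet> w" for w by (simp add: inner_complex_def)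
  show ?thesis
    by (rule linked_geodesics_exists[OF planar_geodesic.rotated[OF A u] planar_geodesic.rotated[OF B u]])
      (simp_all only: ends i m, erule that)
qed

text \<open>Every occurring direction may serve as the axis. If \<open>p - p'\<close> is orthogonal
  to one of them, that direction is chosen and the axial momenta agree. Otherwise
  \<open>(p - p') \<bullet> n\<close> keeps one sign by connectedness and the axis is arbitrary;
  \<open>n 0\<close> is taken.\<close>

lemma coincide_if_acute:
  assumes A: "planar_geodesic L p z n q" and B: "planar_geodesic L' p' z' n' q'"
    and ends: "z 0 = z' 0" "z L = z' L'" "n 0 = n' 0" "n L = n' L'"
    and acute: "\<And>u v. u \<in> n ` {0..L} \<union> n' ` {0..L'} \<Longrightarrow> v \<in> n ` {0..L} \<union> n' ` {0..L'} \<Longrightarrow> 0 < u \<bullet> v"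
  shows "L = L' \<and> (\<forall>s\<in>{0..L}. z s = z' s)"
proof -
  interpret A: planar_geodesic L p z n q by (rule A)
  interpret B: planar_geodesic L' p' z' n' q' by (rule B)
  define U where "U = n ` {0..L} \<union> n' ` {0..L'}"
  have U_unit: "cmod u = 1" if "u \<in> U" for u
    using that A.norm_n B.norm_n unfolding U_def by auto
  have link: "\<exists>h. linked_geodesics L (cnj m * p) (\<lambda>s. cnj m * z s) (\<lambda>s. cnj m * n s) q
    L' (cnj m * p') (\<lambda>s. cnj m * z' s) (\<lambda>s. cnj m * n' s) q' h" if "m \<in> U" for m
    by (rule linked_geodesics_over_axis[OF A B ends U_unit[OF that]])
      (use that in \<open>auto intro!: acute simp: U_def\<close>)
  have strip: "L = L' \<and> (\<forall>s\<in>{0..L}. z s = z' s)"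
    if "m \<in> U" "L = L' \<and> (\<forall>s\<in>{0..L}. cnj m * z s = cnj m * z' s)" for m
  proof -
    have "cnj m \<noteq> 0" using U_unit[OF that(1)] by auto
    then show ?thesis using that(2) by simp
  qed
  show ?thesis
  proof (cases "\<exists>u\<in>U. (p - p') \<bullet> u = 0")
    case True
    then obtain u where u: "u \<in> U" "p \<bullet> u = p' \<bullet> u" by (auto simp: inner_diff_left)
    \<comment> \<open>For \<open>p = p'\<close> every axis gives equal axial momenta, but
      \<open>u\<close> may be the direction at a cusp, where \<open>p \<bullet> u = 0\<close>; at an
      interior time \<open>p \<bullet> m\<close> is positive. For \<open>p \<noteq> p'\<close> the
      strictness comes from the transverse components instead.\<close>
    define m where "m = (if p = p' then n (L / 2) else u)"
    have m: "m \<in> U" using u A.L_pos unfolding m_def U_def by auto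
    have pm: "p \<bullet> m = p' \<bullet> m" using u unfolding m_def by auto
    have nonneg: "0 \<le> p \<bullet> m"
      using m unfolding U_def
    proof (elim UnE imageE)
      fix s assume "m = n s" "s \<in> {0..L}"
      then show "0 \<le> p \<bullet> m" using A.lam_nonneg[of s] by simp
    next
      fix s assume "m = n' s" "s \<in> {0..L'}"
      then show "0 \<le> p \<bullet> m" unfolding pm using B.lam_nonneg[of s] by simp
    qed
    have pos: "0 < p \<bullet> m" if "p = p'"
      using that A.lam_pos[of "L / 2"] A.L_pos unfolding m_def by simp
    have Re: "Re (cnj m * p) = p \<bullet> m" "Re (cnj m * p') = p' \<bullet> m"
      by (simp_all add: inner_complex_def algebra_simps)
    have Im: "Im (cnj m * p) \<noteq> Im (cnj m * p')" if "p \<noteq> p'"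
    proof
      assume "Im (cnj m * p) = Im (cnj m * p')"
      then have "cnj m * p = cnj m * p'" using Re pm by (simp add: complex_eq_iff)
      moreover have "cnj m \<noteq> 0" using U_unit[OF m] by auto
      ultimately show False using that by simp
    qed
    obtain h where "linked_geodesics L (cnj m * p) (\<lambda>s. cnj m * z s) (\<lambda>s. cnj m * n s) q
        L' (cnj m * p') (\<lambda>s. cnj m * z' s) (\<lambda>s. cnj m * n' s) q' h"
      using link[OF m] ..
    then have "L = L' \<and> (\<forall>s\<in>{0..L}. cnj m * z s = cnj m * z' s)"
      by (rule linked_geodesics.coincide_if_equal_axial_momentum)
        (use Re pm nonneg pos Im in \<open>cases "p = p'"; simp\<close>)+
    then show ?thesis by (rule strip[OF m])
  next
    case False
    define m where "m = n 0"
    have m: "m \<in> U" using A.L_pos unfolding m_def U_def by auto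
    have um: "cmod (cnj m) = 1" using U_unit[OF m] by simp
    have "(\<forall>s\<in>{0..L}. 0 < (p - p') \<bullet> n s) \<or> (\<forall>s\<in>{0..L}. (p - p') \<bullet> n s < 0)"
      by (rule continuous_nonzero_same_sign) (use False in \<open>auto intro!: continuous_intros A.cont_n simp: U_def\<close>)
    then have "(\<forall>s\<in>{0..L}. 0 < (cnj m * p - cnj m * p') \<bullet> (cnj m * n s))
        \<or> (\<forall>s\<in>{0..L}. (cnj m * p - cnj m * p') \<bullet> (cnj m * n s) < 0)"
      by (simp only: inner_mult_unit[OF um] right_diff_distrib[symmetric])
    moreover obtain h where "linked_geodesics L (cnj m * p) (\<lambda>s. cnj m * z s) (\<lambda>s. cnj m * n s) q
        L' (cnj m * p') (\<lambda>s. cnj m * z' s) (\<lambda>s. cnj m * n' s) q' h"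
      using link[OF m] ..
    ultimately have "L = L' \<and> (\<forall>s\<in>{0..L}. cnj m * z s = cnj m * z' s)"
      by (intro linked_geodesics.coincide_if_momentum_dominates)
    then show ?thesis by (rule strip[OF m])
  qed
qed

section \<open>Turning angle and inflections\<close>

context planar_geodesic
begin

text \<open>Measured from \<open>n 0\<close>, which two curves with the same end data share, whereas
  \<open>turn\<close> is measured from the individual momentum.\<close>

definition angle :: "real \<Rightarrow> real" where "angle s = turn s - turn 0"

lemma angle_0 [simp]: "angle 0 = 0" by (simp add: angle_def)

lemma n_eq_cis_angle: "0 \<le> s \<Longrightarrow> s \<le> L \<Longrightarrow> n s = n 0 * cis (angle s)"
  unfolding angle_def by (rule n_rotated)

lemma angle_bounds: "0 \<le> s \<Longrightarrow> s \<le> L \<Longrightarrow> \<bar>angle s\<bar> \<le> pi"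
  using turn_bounds[of s] turn_bounds[of 0] L_pos unfolding angle_def by auto

lemma angle_le_iff:
  "0 \<le> s \<Longrightarrow> s \<le> L \<Longrightarrow> 0 \<le> t \<Longrightarrow> t \<le> L \<Longrightarrow> angle s \<le> angle t \<longleftrightarrow> torque_rate s \<le> torque_rate t"
  unfolding angle_def using turn_mono(2)[of s t] by simp

lemma angle_less_iff:
  "0 \<le> s \<Longrightarrow> s \<le> L \<Longrightarrow> 0 \<le> t \<Longrightarrow> t \<le> L \<Longrightarrow> angle s < angle t \<longleftrightarrow> torque_rate s < torque_rate t"
  unfolding angle_def using turn_mono(1)[of s t] by simp

lemma around_inflection:
  assumes s0: "0 \<le> s0" "s0 \<le> L" "q s0 = 0" and s: "0 \<le> s" "s \<le> L"
  shows "q s = torque_rate s0 * sinh (s - s0)" "torque_rate s = torque_rate s0 * cosh (s - s0)"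
proof -
  define r where "r = torque_rate 0"
  have 0: "q 0 * cosh s0 + r * sinh s0 = 0" "torque_rate s0 = r * cosh s0 + q 0 * sinh s0"
    using q_eq[OF s0(1,2)] torque_rate_eq[OF s0(1,2)] s0(3) unfolding r_def by auto
  have e: "cosh s = cosh (s - s0) * cosh s0 + sinh (s - s0) * sinh s0"
    "sinh s = sinh (s - s0) * cosh s0 + cosh (s - s0) * sinh s0"
    using cosh_add[of "s - s0" s0] sinh_add[of "s - s0" s0] by simp_all
  have "q s = (q 0 * cosh s0 + r * sinh s0) * cosh (s - s0) + (r * cosh s0 + q 0 * sinh s0) * sinh (s - s0)"
    unfolding q_eq[OF s] e r_def[symmetric] by (simp only: algebra_simps)
  then show "q s = torque_rate s0 * sinh (s - s0)" unfolding 0 by simp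
  have "torque_rate s = (r * cosh s0 + q 0 * sinh s0) * cosh (s - s0) + (q 0 * cosh s0 + r * sinh s0) * sinh (s - s0)"
    unfolding torque_rate_eq[OF s] e r_def[symmetric] by (simp only: algebra_simps)
  then show "torque_rate s = torque_rate s0 * cosh (s - s0)" unfolding 0 by simp
qed

text \<open>\<open>torque_rate\<close> is its value at \<open>s0\<close> times
  \<open>cosh (s - s0)\<close>, so the angle is least at the inflection and greatest at an end. If
  that value is positive, then \<open>0 < turn s0\<close> while \<open>turn s \<le> pi / 2\<close>,
  which is the origin of the right angle; if it is 0, the direction is constant.\<close>

lemma inflection_angle_range:
  assumes s0: "0 \<le> s0" "s0 \<le> L" "q s0 = 0" and pos: "0 \<le> torque_rate s0" and s: "0 \<le> s" "s \<le> L"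
  shows "angle s0 \<le> angle s" "angle s \<le> max 0 (angle L)" "angle s - angle s0 < pi / 2"
proof -
  have r: "torque_rate t = torque_rate s0 * cosh (t - s0)" if "0 \<le> t" "t \<le> L" for t
    using around_inflection(2)[OF s0 that] .
  have "torque_rate s0 * 1 \<le> torque_rate s0 * cosh (s - s0)"
    using pos by (intro mult_left_mono cosh_real_ge_1)
  then show "angle s0 \<le> angle s"
    using angle_le_iff[of s0 s] r[OF s] s0 s by simp
  show "angle s \<le> max 0 (angle L)"
  proof (cases "s \<le> s0")
    case True
    have "cosh (s0 - s) \<le> cosh (s0 - 0)" using True s by (subst cosh_real_nonneg_le_iff) auto
    then have "cosh (s - s0) \<le> cosh (0 - s0)" by (metis cosh_minus minus_diff_eq)
    then have "torque_rate s \<le> torque_rate 0"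
      using r[OF s] r[of 0] pos L_pos by (metis less_imp_le mult_left_mono order_refl)
    then show ?thesis using angle_le_iff[of s 0] s L_pos by simp
  next
    case False
    have "cosh (s - s0) \<le> cosh (L - s0)" using False s by (subst cosh_real_nonneg_le_iff) auto
    then have "torque_rate s \<le> torque_rate L"
      using r[OF s] r[of L] pos L_pos by (metis less_imp_le mult_left_mono order_refl)
    then show ?thesis using angle_le_iff[of s L] s L_pos by simp
  qed
  show "angle s - angle s0 < pi / 2"
  proof (cases "torque_rate s0 = 0")
    case True
    then have "torque_rate s = torque_rate s0" using r[OF s] by simp
    then show ?thesis unfolding angle_def turn_def by simp
  next
    case False
    have "0 < torque_rate s0 / cmod p" using pos False p_nonzero by simp
    then have "0 < turn s0" unfolding turn_def
      using arcsin_less_arcsin[of 0 "torque_rate s0 / cmod p"] torque_rate_bound[OF s0(1,2)] by simp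
    then show ?thesis using turn_bounds[OF s] unfolding angle_def by simp
  qed
qed

lemma increasing_axial:
  assumes "0 \<le> s" "s < t" "t \<le> L"
  shows "p \<bullet> z s < p \<bullet> z t"
  unfolding inner_p(2)
proof (rule increasing_from_derivative[OF assms(2)])
  show "continuous_on {s..t} (\<lambda>s. Re p * Re (z s) + Im p * Im (z s))"
    using continuous_on_subset[OF cont_z, of "{s..t}"] assms by (auto intro!: continuous_intros)
  show "((\<lambda>s. Re p * Re (z s) + Im p * Im (z s)) has_real_derivative lam u) (at u)" if "s < u" "u < t" for u
    unfolding inner_p(2) by (intro DERIV_add DERIV_cmult dRe_z dIm_z) (use that assms in auto)
  show "0 < lam u" if "s < u" "u < t" for u using lam_pos[of u] that assms by auto
qed

lemma increasing_angle:
  assumes "\<forall>s\<in>{0<..<L}. 0 < q s" "0 \<le> s" "s < t" "t \<le> L"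
  shows "angle s < angle t"
proof -
  have "torque_rate s < torque_rate t"
    by (rule increasing_from_derivative[OF assms(3) _ dtorque_rate])
      (use assms continuous_on_subset[OF cont_torque_rate, of "{s..t}"] in auto)
  then show ?thesis using angle_less_iff[of s t] assms by auto
qed

lemma decreasing_angle:
  assumes "\<forall>s\<in>{0<..<L}. q s < 0" "0 \<le> s" "s < t" "t \<le> L"
  shows "angle t < angle s"
proof -
  have "torque_rate t < torque_rate s"
    by (rule decreasing_from_derivative[OF assms(3) _ dtorque_rate])
      (use assms continuous_on_subset[OF cont_torque_rate, of "{s..t}"] in auto)
  then show ?thesis using angle_less_iff[of t s] assms by auto
qed

lemma inflection_dichotomy:
  obtains (inflection) s0 where "0 < s0" "s0 < L" "q s0 = 0"
  | (pos) "\<forall>s\<in>{0<..<L}. 0 < q s"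
  | (neg) "\<forall>s\<in>{0<..<L}. q s < 0"
proof (cases "\<exists>s0. 0 < s0 \<and> s0 < L \<and> q s0 = 0")
  case False
  have "continuous_on {0<..<L} q" by (rule continuous_on_subset[OF cont_q]) auto
  then have "(\<forall>s\<in>{0<..<L}. 0 < q s) \<or> (\<forall>s\<in>{0<..<L}. q s < 0)"
    by (rule continuous_nonzero_same_sign) (use False in auto)
  then show ?thesis using pos neg by blast
qed (use inflection in blast)

lemma no_inflection_angle_range:
  assumes nz: "\<forall>s\<in>{0<..<L}. q s \<noteq> 0" and s: "0 \<le> s" "s \<le> L"
  shows "min 0 (angle L) \<le> angle s" "angle s \<le> max 0 (angle L)"
proof -
  have "min 0 (angle L) \<le> angle s \<and> angle s \<le> max 0 (angle L)"
  proof (rule inflection_dichotomy)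
    assume "\<forall>s\<in>{0<..<L}. 0 < q s"
    then have "0 < s \<Longrightarrow> 0 < angle s" "s < L \<Longrightarrow> angle s < angle L"
      using increasing_angle[of 0 s] increasing_angle[of s L] s by auto
    then show ?thesis using s by (cases "s = 0"; cases "s = L") auto
  next
    assume "\<forall>s\<in>{0<..<L}. q s < 0"
    then have "0 < s \<Longrightarrow> angle s < 0" "s < L \<Longrightarrow> angle L < angle s"
      using decreasing_angle[of 0 s] decreasing_angle[of s L] s by auto
    then show ?thesis using s by (cases "s = 0"; cases "s = L") auto
  qed (use nz in auto)
  then show "min 0 (angle L) \<le> angle s" "angle s \<le> max 0 (angle L)" by auto
qed

lemma q_0_nonneg:
  assumes q: "\<forall>s\<in>{0<..<L}. 0 < q s"
  shows "0 \<le> q 0"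
proof (rule ccontr)
  assume "\<not> 0 \<le> q 0"
  then have "0 < - q 0" by simp
  then obtain e where e: "0 < e" "\<And>y. y \<in> {0..L} \<Longrightarrow> \<bar>y - 0\<bar> < e \<Longrightarrow> 0 < - q y"
    using eventually_positive_near[OF continuous_on_minus[OF cont_q], of 0] L_pos
    by (metis atLeastAtMost_iff less_imp_le order_refl)
  obtain t where t: "0 < t" "t < min L e" using dense[of 0 "min L e"] e(1) L_pos by auto
  then show False using e(2)[of t] q by (auto dest: bspec[of _ _ t])
qed

end

lemma cis_eq_imp_eq:
  assumes "cis a = cis b" "\<bar>a - b\<bar> < 2 * pi" shows "a = b"
proof -
  have "cis (a - b) = 1" using assms by (simp add: cis_divide[symmetric])
  then have "cos (a - b) = 1" by (simp add: complex_eq_iff)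
  then obtain k :: int where "a - b = of_int k * 2 * pi" using cos_one_2pi_int by auto
  then show ?thesis using assms(2) by (cases "k = 0") (auto simp: abs_mult)
qed

section \<open>Uniqueness of planar geodesics\<close>

lemma inner_unit_cis: "cmod w = 1 \<Longrightarrow> (w * cis a) \<bullet> (w * cis b) = cos (a - b)"
  by (simp add: inner_mult_unit) (simp add: inner_complex_def cos_diff)

locale geodesic_pair =
  A: planar_geodesic L p z n q + B: planar_geodesic L' p' z' n' q'
  for L p z n q L' p' z' n' q' +
  assumes z_ends: "z 0 = z' 0" "z L = z' L'"
    and n_ends: "n 0 = n' 0" "n L = n' L'"
begin

abbreviation coincide :: bool where
  "coincide \<equiv> L = L' \<and> (\<forall>s\<in>{0..L}. z s = z' s)"

lemma reflected: "geodesic_pair L (cnj p) (\<lambda>s. cnj (z s)) (\<lambda>s. cnj (n s)) (\<lambda>s. - q s)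
   L' (cnj p') (\<lambda>s. cnj (z' s)) (\<lambda>s. cnj (n' s)) (\<lambda>s. - q' s)"
  unfolding geodesic_pair_def geodesic_pair_axioms_def
  using A.reflected B.reflected z_ends n_ends by simp

lemma swapped: "geodesic_pair L' p' z' n' q' L p z n q"
  unfolding geodesic_pair_def geodesic_pair_axioms_def
  using A.planar_geodesic_axioms B.planar_geodesic_axioms z_ends n_ends by simp

lemma n0_unit: "cmod (n 0) = 1"
  using A.norm_n[of 0] A.L_pos by simp

lemma cis_angles: "cis (A.angle L) = cis (B.angle L')"
proof -
  have "n 0 * cis (A.angle L) = n 0 * cis (B.angle L')"
    using A.n_eq_cis_angle[of L] B.n_eq_cis_angle[of L'] n_ends A.L_pos B.L_pos by auto
  moreover have "n 0 \<noteq> 0" using n0_unit by auto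
  ultimately show ?thesis by (simp only: mult_cancel_left) simp
qed

lemma coincide_if_narrow:
  assumes "\<And>s. 0 \<le> s \<Longrightarrow> s \<le> L \<Longrightarrow> lo \<le> A.angle s \<and> A.angle s \<le> hi"
    and "\<And>s. 0 \<le> s \<Longrightarrow> s \<le> L' \<Longrightarrow> lo \<le> B.angle s \<and> B.angle s \<le> hi"
    and "hi - lo < pi / 2"
  shows coincide
proof (rule coincide_if_acute[OF A.planar_geodesic_axioms B.planar_geodesic_axioms z_ends n_ends])
  have *: "\<exists>a. lo \<le> a \<and> a \<le> hi \<and> u = n 0 * cis a" if "u \<in> n ` {0..L} \<union> n' ` {0..L'}" for u
    using that
  proof (elim UnE imageE)
    fix s assume s: "u = n s" "s \<in> {0..L}"
    then show ?thesis using A.n_eq_cis_angle[of s] assms(1)[of s] by (intro exI[of _ "A.angle s"]) simp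
  next
    fix s assume s: "u = n' s" "s \<in> {0..L'}"
    then show ?thesis using B.n_eq_cis_angle[of s] assms(2)[of s] n_ends(1) by (intro exI[of _ "B.angle s"]) simp
  qed
  fix u v assume "u \<in> n ` {0..L} \<union> n' ` {0..L'}" "v \<in> n ` {0..L} \<union> n' ` {0..L'}"
  then obtain a b where ab: "lo \<le> a" "a \<le> hi" "u = n 0 * cis a" "lo \<le> b" "b \<le> hi" "v = n 0 * cis b"
    using *[of u] *[of v] by blast
  show "0 < u \<bullet> v"
    unfolding ab(3,6) inner_unit_cis[OF n0_unit]
    by (rule cos_gt_zero_pi) (use ab assms(3) in linarith)+
qed

text \<open>Without inflection, the second curve stays between the two end directions, which the
  range of the first one contains. With an inflection of the same kind, both ranges have the upper
  end \<open>max 0 (A.angle L)\<close> and reach less than a right angle below it. With an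
  inflection of the opposite kind, the ranges open to opposite sides and their union may exceed a
  right angle; but all directions are acute to \<open>n 0\<close>, and the two torques are monotone
  in opposite senses.\<close>

lemma coincide_if_inflection_pos:
  assumes s0: "0 < s0" "s0 < L" "q s0 = 0" and pos: "0 \<le> A.torque_rate s0"
  shows coincide
proof -
  have s0': "0 \<le> s0" "s0 \<le> L" using s0 by auto
  note A_range = A.inflection_angle_range[OF s0' s0(3) pos]
  have L: "0 \<le> L" "0 \<le> L'" using A.L_pos B.L_pos by auto
  have "\<bar>A.angle L\<bar> < pi / 2"
    using A_range[of 0] A_range[of L] L by auto
  \<comment> \<open>The end directions determine the angles up to a multiple of
    \<open>2 * pi\<close>; the bounds \<open>pi / 2\<close> and \<open>pi\<close> leave only
    equality.\<close>
  then have angles: "A.angle L = B.angle L'"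
    using cis_eq_imp_eq[OF cis_angles] B.angle_bounds[of L'] L pi_gt_zero by linarith
  have A_lo: "A.angle s0 \<le> 0" "A.angle s0 \<le> A.angle L"
    using A_range(1)[of 0] A_range(1)[of L] L by auto
  have A_hi: "max 0 (A.angle L) - A.angle s0 < pi / 2"
    using A_range(3)[of 0] A_range(3)[of L] L by (simp add: max_def)
  show ?thesis
  proof (cases "\<exists>t0. 0 < t0 \<and> t0 < L' \<and> q' t0 = 0")
    case False
    then have nz: "\<forall>s\<in>{0<..<L'}. q' s \<noteq> 0" by auto
    show ?thesis
    proof (rule coincide_if_narrow[OF _ _ A_hi])
      show "A.angle s0 \<le> A.angle s \<and> A.angle s \<le> max 0 (A.angle L)" if "0 \<le> s" "s \<le> L" for s
        using A_range[OF that] by simp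
      show "A.angle s0 \<le> B.angle s \<and> B.angle s \<le> max 0 (A.angle L)" if "0 \<le> s" "s \<le> L'" for s
        using B.no_inflection_angle_range[OF nz that] A_lo angles by (simp add: min_def split: if_splits)
    qed
  next
    case True
    then obtain t0 where t0: "0 < t0" "t0 < L'" "q' t0 = 0" by blast
    have t0': "0 \<le> t0" "t0 \<le> L'" using t0 by auto
    show ?thesis
    proof (cases "0 \<le> B.torque_rate t0")
      case True
      note B_range = B.inflection_angle_range[OF t0' t0(3) True]
      have B_hi: "max 0 (A.angle L) - B.angle t0 < pi / 2"
        using B_range(3)[of 0] B_range(3)[of L'] L angles by (simp add: max_def)
      show ?thesis
      proof (rule coincide_if_narrow[of "min (A.angle s0) (B.angle t0)" "max 0 (A.angle L)"])
        show "min (A.angle s0) (B.angle t0) \<le> A.angle s \<and> A.angle s \<le> max 0 (A.angle L)"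
          if "0 \<le> s" "s \<le> L" for s using A_range[OF that] by auto
        show "min (A.angle s0) (B.angle t0) \<le> B.angle s \<and> B.angle s \<le> max 0 (A.angle L)"
          if "0 \<le> s" "s \<le> L'" for s using B_range[OF that] angles by auto
      qed (use A_hi B_hi in linarith)
    next
      case False
      interpret R: planar_geodesic L' "cnj p'" "\<lambda>s. cnj (z' s)" "\<lambda>s. cnj (n' s)" "\<lambda>s. - q' s"
        by (rule B.reflected)
      have flip: "R.torque_rate s = - B.torque_rate s" for s by simp
      have "B.angle s = - R.angle s" if "0 \<le> s" "s \<le> L'" for s
      proof -
        have "R.turn s = - B.turn s" if "0 \<le> s" "s \<le> L'" for s
          using arcsin_minus[OF B.torque_rate_bound[OF that]]
          by (simp only: R.turn_def B.turn_def flip complex_mod_cnj minus_divide_left[symmetric])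
        then show ?thesis using that L unfolding R.angle_def B.angle_def by simp
      qed
      moreover have "\<bar>R.angle s\<bar> < pi / 2" if s: "0 \<le> s" "s \<le> L'" for s
      proof -
        have "0 \<le> R.torque_rate t0" "- q' t0 = 0" using False t0(3) unfolding flip by auto
        note R_range = R.inflection_angle_range[OF t0' this(2,1)]
        show ?thesis using R_range[OF s] R_range[of 0] L by auto
      qed
      ultimately have B_acute: "\<bar>B.angle s\<bar> < pi / 2" if "0 \<le> s" "s \<le> L'" for s
        using that by simp
      have A_acute: "\<bar>A.angle s\<bar> < pi / 2" if "0 \<le> s" "s \<le> L" for s
        using A_range[of s] A_range[of 0] that L by auto
      have dot: "n 0 \<bullet> (n 0 * cis a) = cos a" for a
        using inner_unit_cis[OF n0_unit, of 0 a] by simp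
      have "\<exists>h. linked_geodesics L (cnj (n 0) * p) (\<lambda>s. cnj (n 0) * z s) (\<lambda>s. cnj (n 0) * n s) q
          L' (cnj (n 0) * p') (\<lambda>s. cnj (n 0) * z' s) (\<lambda>s. cnj (n 0) * n' s) q' h"
      proof (rule linked_geodesics_over_axis[OF A.planar_geodesic_axioms B.planar_geodesic_axioms z_ends n_ends n0_unit])
        show "0 < n 0 \<bullet> n s" if "0 \<le> s" "s \<le> L" for s
          unfolding A.n_eq_cis_angle[OF that] dot using A_acute[OF that] by (intro cos_gt_zero_pi) auto
        show "0 < n 0 \<bullet> n' s" if "0 \<le> s" "s \<le> L'" for s
          unfolding B.n_eq_cis_angle[OF that] n_ends(1)[symmetric] dot
          using B_acute[OF that] by (intro cos_gt_zero_pi) auto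
      qed blast
      then obtain h where h: "linked_geodesics L (cnj (n 0) * p) (\<lambda>s. cnj (n 0) * z s) (\<lambda>s. cnj (n 0) * n s) q
          L' (cnj (n 0) * p') (\<lambda>s. cnj (n 0) * z' s) (\<lambda>s. cnj (n 0) * n' s) q' h" ..
      have "L = L' \<and> (\<forall>s\<in>{0..L}. cnj (n 0) * z s = cnj (n 0) * z' s)"
      proof (rule linked_geodesics.coincide_if_opposite_monotone[OF h])
        show "q s \<le> q t" if "0 \<le> s" "s < t" "t \<le> L" for s t
          using A.around_inflection(1)[OF s0' s0(3), of s] A.around_inflection(1)[OF s0' s0(3), of t] that pos
          by (simp add: mult_left_mono)
        show "q' t < q' s" if "0 \<le> s" "s < t" "t \<le> L'" for s t
          using B.around_inflection(1)[OF t0' t0(3), of s] B.around_inflection(1)[OF t0' t0(3), of t] that False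
          by (simp add: mult_strict_left_mono_neg)
      qed
      moreover have "n 0 \<noteq> 0" using n0_unit by auto
      ultimately show ?thesis by simp
    qed
  qed
qed

lemma coincide_if_inflection:
  assumes s0: "0 < s0" "s0 < L" "q s0 = 0"
  shows coincide
proof (cases "0 \<le> A.torque_rate s0")
  case False
  interpret R: geodesic_pair L "cnj p" "\<lambda>s. cnj (z s)" "\<lambda>s. cnj (n s)" "\<lambda>s. - q s"
    L' "cnj p'" "\<lambda>s. cnj (z' s)" "\<lambda>s. cnj (n' s)" "\<lambda>s. - q' s"
    by (rule reflected)
  have "L = L' \<and> (\<forall>s\<in>{0..L}. cnj (z s) = cnj (z' s))"
    by (rule R.coincide_if_inflection_pos[of s0]) (use s0 False in auto)
  then show ?thesis by simp
qed (use coincide_if_inflection_pos s0 in blast)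

text \<open>The momentum and the initial torque determine \<open>torque_rate\<close> by an explicit
  formula, hence \<open>turn\<close> and the direction, also when the motion starts at a cusp. The
  lengths agree because \<open>p \<bullet> z\<close> increases strictly, so the longer curve cannot
  revisit the common end point.\<close>

lemma coincide_if_equal_momentum:
  assumes "p = p'" "q 0 = q' 0"
  shows coincide
proof -
  have q: "q s = q' s" and r: "A.torque_rate s = B.torque_rate s"
    if "0 \<le> s" "s \<le> L" "s \<le> L'" for s
    using A.q_eq[of s] B.q_eq[of s] A.torque_rate_eq[of s] B.torque_rate_eq[of s] that assms n_ends(1) by auto
  have n: "n s = n' s" if "0 \<le> s" "s \<le> L" "s \<le> L'" for s
    using A.n_eq_cis_turn[of s] B.n_eq_cis_turn[of s] r[OF that] that assms(1)
    unfolding A.turn_def B.turn_def by simp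
  have z: "z s = z' s" if s: "0 \<le> s" "s \<le> L" "s \<le> L'" for s
  proof -
    have "f s = f 0" if f: "continuous_on {0..s} f" "\<And>t. 0 < t \<Longrightarrow> t < s \<Longrightarrow> (f has_real_derivative 0) (at t)" for f
    proof (cases "s = 0")
      case False
      then show ?thesis using DERIV_isconst2[of 0 s f s] f s by auto
    qed simp
    note const = this
    have cz: "continuous_on {0..s} z" "continuous_on {0..s} z'"
      using continuous_on_subset[OF A.cont_z] continuous_on_subset[OF B.cont_z] s by auto
    have "Re (z s) - Re (z' s) = Re (z 0) - Re (z' 0)"
    proof (rule const)
      show "((\<lambda>s. Re (z s) - Re (z' s)) has_real_derivative 0) (at t)" if "0 < t" "t < s" for t
        using DERIV_diff[OF A.dRe_z[of t] B.dRe_z[of t]] n[of t] that s by simp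
    qed (intro continuous_intros cz)
    moreover have "Im (z s) - Im (z' s) = Im (z 0) - Im (z' 0)"
    proof (rule const)
      show "((\<lambda>s. Im (z s) - Im (z' s)) has_real_derivative 0) (at t)" if "0 < t" "t < s" for t
        using DERIV_diff[OF A.dIm_z[of t] B.dIm_z[of t]] n[of t] that s by simp
    qed (intro continuous_intros cz)
    ultimately show ?thesis using z_ends by (simp add: complex_eq_iff)
  qed
  have "L = L'"
  proof (cases L L' rule: linorder_cases)
    case less
    then show ?thesis using B.increasing_axial[of L L'] z[of L] z_ends A.L_pos by simp
  next
    case greater
    then show ?thesis using A.increasing_axial[of L' L] z[of L'] z_ends B.L_pos by simp
  qed
  then show ?thesis using z by auto
qed

text \<open>Calibration: with \<open>G' = gp - gp'\<close>, where \<open>gp\<close> and \<open>gp'\<close> are the torques that the two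
  momenta induce at a given direction, the function \<open>(p - p') \<bullet> x + G\<close> is monotone in opposite
  senses along the two curves, by the Cauchy-Schwarz inequality.\<close>

lemma coincide_if_both_pos:
  assumes q: "\<forall>s\<in>{0<..<L}. 0 < q s" and q': "\<forall>s\<in>{0<..<L'}. 0 < q' s"
  shows coincide
proof -
  have L: "0 \<le> L" "0 \<le> L'" using A.L_pos B.L_pos by auto
  have pos: "0 < A.angle L" "0 < B.angle L'"
    using A.increasing_angle[OF q, of 0 L] B.increasing_angle[OF q', of 0 L'] A.L_pos B.L_pos by auto
  have angles: "A.angle L = B.angle L'"
    using cis_eq_imp_eq[OF cis_angles] A.angle_bounds[of L] B.angle_bounds[of L'] L pos pi_gt_zero by linarith
  define \<theta> where "\<theta> = A.angle L"
  define dir where "dir a = n 0 * cis a" for a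
  define gp where "gp a = sqrt (1 - (p \<bullet> dir a)\<^sup>2)" for a
  define gp' where "gp' a = sqrt (1 - (p' \<bullet> dir a)\<^sup>2)" for a
  have cA: "continuous_on {0..L} A.angle" and cB: "continuous_on {0..L'} B.angle"
    unfolding A.angle_def B.angle_def by (intro continuous_intros A.cont_turn B.cont_turn)+
  have dirA: "dir (A.angle s) = n s" if "0 \<le> s" "s \<le> L" for s
    unfolding dir_def using A.n_eq_cis_angle[OF that] by simp
  have dirB: "dir (B.angle s) = n' s" if "0 \<le> s" "s \<le> L'" for s
    unfolding dir_def n_ends using B.n_eq_cis_angle[OF that] by simp
  have nz: "\<forall>s\<in>{0<..<L}. q s \<noteq> 0" and nz': "\<forall>s\<in>{0<..<L'}. q' s \<noteq> 0"
    using q q' by force+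
  have rA: "0 \<le> A.angle s" "A.angle s \<le> \<theta>" if "0 \<le> s" "s \<le> L" for s
    using A.no_inflection_angle_range[OF nz that] pos unfolding \<theta>_def by auto
  have rB: "0 \<le> B.angle s" "B.angle s \<le> \<theta>" if "0 \<le> s" "s \<le> L'" for s
    using B.no_inflection_angle_range[OF nz' that] pos unfolding \<theta>_def angles by auto
  have sA: "0 < A.angle s" "A.angle s < \<theta>" if "0 < s" "s < L" for s
    using A.increasing_angle[OF q, of 0 s] A.increasing_angle[OF q, of s L] that unfolding \<theta>_def by auto
  have sB: "0 < B.angle s" "B.angle s < \<theta>" if "0 < s" "s < L'" for s
    using B.increasing_angle[OF q', of 0 s] B.increasing_angle[OF q', of s L'] that unfolding \<theta>_def angles by auto
  \<comment> \<open>By the intermediate value theorem each curve attains every direction between the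
    two end directions. So the radicands of both \<open>gp\<close> and \<open>gp'\<close> are
    nonnegative on the whole range, and the calibration of one curve can be evaluated along the
    other.\<close>
  have lamA: "0 \<le> p \<bullet> dir a" "(p \<bullet> dir a)\<^sup>2 \<le> 1" if a: "0 \<le> a" "a \<le> \<theta>" for a
  proof -
    obtain s where s: "0 \<le> s" "s \<le> L" "A.angle s = a"
      using IVT'[of A.angle 0 a L] cA a L unfolding \<theta>_def by auto
    have "(A.lam s)\<^sup>2 \<le> 1" using A.energy[OF s(1,2)] zero_le_power2[of "q s"] by linarith
    then show "0 \<le> p \<bullet> dir a" "(p \<bullet> dir a)\<^sup>2 \<le> 1"
      using A.lam_nonneg[OF s(1,2)] dirA[OF s(1,2)] s(3) by auto
  qed
  have lamB: "0 \<le> p' \<bullet> dir a" "(p' \<bullet> dir a)\<^sup>2 \<le> 1" if a: "0 \<le> a" "a \<le> \<theta>" for a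
  proof -
    obtain s where s: "0 \<le> s" "s \<le> L'" "B.angle s = a"
      using IVT'[of B.angle 0 a L'] cB a L unfolding \<theta>_def angles by auto
    have "(B.lam s)\<^sup>2 \<le> 1" using B.energy[OF s(1,2)] zero_le_power2[of "q' s"] by linarith
    then show "0 \<le> p' \<bullet> dir a" "(p' \<bullet> dir a)\<^sup>2 \<le> 1"
      using B.lam_nonneg[OF s(1,2)] dirB[OF s(1,2)] s(3) by auto
  qed
  have qA: "q s = gp (A.angle s)" if "0 < s" "s < L" for s
  proof -
    have "1 - (p \<bullet> dir (A.angle s))\<^sup>2 = (q s)\<^sup>2" using A.energy[of s] dirA[of s] that by simp
    then show ?thesis unfolding gp_def using bspec[OF q, of s] that by simp
  qed
  have qB: "q' s = gp' (B.angle s)" if "0 < s" "s < L'" for s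
  proof -
    have "1 - (p' \<bullet> dir (B.angle s))\<^sup>2 = (q' s)\<^sup>2" using B.energy[of s] dirB[of s] that by simp
    then show ?thesis unfolding gp'_def using bspec[OF q', of s] that by simp
  qed
  \<comment> \<open>The pairs of axial value and torque are unit vectors, so twice the defect in the
    inequality is the square of their distance; this also settles the case of equality.\<close>
  have cauchy: "(p \<bullet> dir a) * (p' \<bullet> dir a) + gp a * gp' a \<le> 1"
    and cauchy_eq: "(p \<bullet> dir a) * (p' \<bullet> dir a) + gp a * gp' a = 1 \<Longrightarrow> p \<bullet> dir a = p' \<bullet> dir a"
    if "0 \<le> a" "a \<le> \<theta>" for a
  proof -
    have "(gp a)\<^sup>2 = 1 - (p \<bullet> dir a)\<^sup>2" "(gp' a)\<^sup>2 = 1 - (p' \<bullet> dir a)\<^sup>2"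
      unfolding gp_def gp'_def using lamA[OF that] lamB[OF that] by auto
    then have e: "2 * (1 - ((p \<bullet> dir a) * (p' \<bullet> dir a) + gp a * gp' a))
        = (p \<bullet> dir a - p' \<bullet> dir a)\<^sup>2 + (gp a - gp' a)\<^sup>2"
      by (simp add: power2_diff)
    have "0 \<le> 2 * (1 - ((p \<bullet> dir a) * (p' \<bullet> dir a) + gp a * gp' a))" unfolding e by simp
    then show "(p \<bullet> dir a) * (p' \<bullet> dir a) + gp a * gp' a \<le> 1" by simp
    show "p \<bullet> dir a = p' \<bullet> dir a" if "(p \<bullet> dir a) * (p' \<bullet> dir a) + gp a * gp' a = 1"
      using e that by (simp add: sum_power2_eq_zero_iff)
  qed
  define G where "G a = integral {0..a} (\<lambda>a. gp a - gp' a)" for a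
  have cg: "continuous_on {0..\<theta>} (\<lambda>a. gp a - gp' a)"
    unfolding gp_def gp'_def dir_def inner_complex_def by (intro continuous_intros)
  have dG: "(G has_real_derivative gp a - gp' a) (at a within {0..\<theta>})" if "0 \<le> a" "a \<le> \<theta>" for a
    using integral_has_real_derivative[OF cg, of a] that unfolding G_def by simp
  then have cG: "continuous_on {0..\<theta>} G"
    by (metis atLeastAtMost_iff continuous_on_eq_continuous_within DERIV_continuous)
  have dG': "(G has_real_derivative gp a - gp' a) (at a)" if "0 < a" "a < \<theta>" for a
    using dG[of a] that at_within_Icc_at[of 0 a \<theta>] by auto
  define \<delta> where "\<delta> = p - p'"
  define FA where "FA s = Re \<delta> * Re (z s) + Im \<delta> * Im (z s) + G (A.angle s)" for s
  define FB where "FB s = Re \<delta> * Re (z' s) + Im \<delta> * Im (z' s) + G (B.angle s)" for s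
  define gap where "gap a = 1 - ((p \<bullet> dir a) * (p' \<bullet> dir a) + gp a * gp' a)" for a
  have dFA: "(FA has_real_derivative gap (A.angle s) / A.lam s) (at s)" if s: "0 < s" "s < L" for s
  proof -
    have dA: "(A.angle has_real_derivative A.curv s) (at s)"
      unfolding A.angle_def using DERIV_diff[OF A.dturn[OF s] DERIV_const] by simp
    have lam: "0 < A.lam s" using A.lam_pos[OF s] .
    have "(FA has_real_derivative Re \<delta> * Re (n s) + Im \<delta> * Im (n s)
        + (gp (A.angle s) - gp' (A.angle s)) * A.curv s) (at s)"
      unfolding FA_def
      by (intro DERIV_add DERIV_cmult A.dRe_z A.dIm_z s DERIV_chain2[OF dG' dA] sA)
    moreover have "Re \<delta> * Re (n s) + Im \<delta> * Im (n s) = A.lam s - p' \<bullet> n s"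
      unfolding \<delta>_def inner_complex_def by (simp add: algebra_simps)
    \<comment> \<open>After multiplication by \<open>lam\<close>, the terms in \<open>p\<close>
      alone sum to \<open>lam\<close> squared plus \<open>q\<close> squared, which is 1; the mixed
      terms complete it to \<open>gap\<close>.\<close>
    moreover have "A.lam s - p' \<bullet> n s + (gp (A.angle s) - gp' (A.angle s)) * A.curv s
        = gap (A.angle s) / A.lam s"
    proof -
      have "(q s)\<^sup>2 + (A.lam s)\<^sup>2 = 1" using A.energy[of s] s by simp
      then have "(A.lam s - p' \<bullet> n s) * A.lam s + (gp (A.angle s) - gp' (A.angle s)) * q s = gap (A.angle s)"
        unfolding gap_def qA[OF s] using dirA[of s] s by (simp add: power2_eq_square algebra_simps)
      moreover have "A.lam s - p' \<bullet> n s + (gp (A.angle s) - gp' (A.angle s)) * A.curv s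
          = ((A.lam s - p' \<bullet> n s) * A.lam s + (gp (A.angle s) - gp' (A.angle s)) * q s) / A.lam s"
        using lam by (simp add: add_divide_distrib)
      ultimately show ?thesis by (simp only:)
    qed
    ultimately show ?thesis by simp
  qed
  have dFB: "(FB has_real_derivative - gap (B.angle s) / B.lam s) (at s)" if s: "0 < s" "s < L'" for s
  proof -
    have dB: "(B.angle has_real_derivative B.curv s) (at s)"
      unfolding B.angle_def using DERIV_diff[OF B.dturn[OF s] DERIV_const] by simp
    have lam: "0 < B.lam s" using B.lam_pos[OF s] .
    have "(FB has_real_derivative Re \<delta> * Re (n' s) + Im \<delta> * Im (n' s)
        + (gp (B.angle s) - gp' (B.angle s)) * B.curv s) (at s)"
      unfolding FB_def
      by (intro DERIV_add DERIV_cmult B.dRe_z B.dIm_z s DERIV_chain2[OF dG' dB] sB)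
    moreover have "Re \<delta> * Re (n' s) + Im \<delta> * Im (n' s) = p \<bullet> n' s - B.lam s"
      unfolding \<delta>_def inner_complex_def by (simp add: algebra_simps)
    moreover have "p \<bullet> n' s - B.lam s + (gp (B.angle s) - gp' (B.angle s)) * B.curv s
        = - gap (B.angle s) / B.lam s"
    proof -
      have "(q' s)\<^sup>2 + (B.lam s)\<^sup>2 = 1" using B.energy[of s] s by simp
      then have "(p \<bullet> n' s - B.lam s) * B.lam s + (gp (B.angle s) - gp' (B.angle s)) * q' s = - gap (B.angle s)"
        unfolding gap_def qB[OF s] using dirB[of s] s by (simp add: power2_eq_square algebra_simps)
      moreover have "p \<bullet> n' s - B.lam s + (gp (B.angle s) - gp' (B.angle s)) * B.curv s
          = ((p \<bullet> n' s - B.lam s) * B.lam s + (gp (B.angle s) - gp' (B.angle s)) * q' s) / B.lam s"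
        using lam by (simp add: add_divide_distrib)
      ultimately show ?thesis by (simp only:)
    qed
    ultimately show ?thesis by simp
  qed
  have FA_cont: "continuous_on {0..L} FA" unfolding FA_def
    by (intro continuous_intros A.cont_z continuous_on_compose2[OF cG cA]) (use rA in auto)
  have FB_cont: "continuous_on {0..L'} FB" unfolding FB_def
    by (intro continuous_intros B.cont_z continuous_on_compose2[OF cG cB]) (use rB in auto)
  have ends: "FA 0 = FB 0" "FA L = FB L'"
    unfolding FA_def FB_def using z_ends angles by auto
  have gap_nonneg: "0 \<le> gap a" if "0 \<le> a" "a \<le> \<theta>" for a
    using cauchy[OF that] unfolding gap_def by simp
  have FB_mono: "FB L' \<le> FB 0"
  proof (rule DERIV_nonpos_imp_decreasing_open[OF L(2) _ FB_cont])
    fix s assume s: "0 < s" "s < L'"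
    have "- gap (B.angle s) / B.lam s \<le> 0"
      using gap_nonneg[of "B.angle s"] rB[of s] s B.lam_pos[OF s] by simp
    then show "\<exists>y. (FB has_real_derivative y) (at s) \<and> y \<le> 0" using dFB[OF s] by blast
  qed
  have FA_mono: "FA s \<le> FA t" if "0 \<le> s" "s \<le> t" "t \<le> L" for s t
  proof (rule DERIV_nonneg_imp_increasing_open[OF that(2)])
    fix u assume u: "s < u" "u < t"
    then have u': "0 < u" "u < L" using that by auto
    then have "0 \<le> gap (A.angle u) / A.lam u"
      using gap_nonneg[of "A.angle u"] rA[of u] A.lam_pos[of u] by simp
    then show "\<exists>y. (FA has_real_derivative y) (at u) \<and> 0 \<le> y" using dFA[OF u'] by blast
  qed (use continuous_on_subset[OF FA_cont] that in auto)
  \<comment> \<open>\<open>FA\<close> increases and \<open>FB\<close> decreases between the same two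
    end values, so neither can move.\<close>
  have FA_const: "FA s = FA 0" if "0 \<le> s" "s \<le> L" for s
    using FA_mono[of 0 s] FA_mono[of s L] FB_mono ends that by linarith
  have orth: "\<delta> \<bullet> n s = 0" if s: "0 < s" "s < L" for s
  proof -
    have "(FA has_real_derivative 0) (at s)"
    proof (rule has_field_derivative_transform_within_open[of "\<lambda>_. FA 0" 0 s "{0<..<L}"])
      show "FA 0 = FA t" if "t \<in> {0<..<L}" for t using FA_const[of t] that by simp
    qed (use s in auto)
    then have "gap (A.angle s) / A.lam s = 0" using dFA[OF s] DERIV_unique by blast
    then have "gap (A.angle s) = 0" using A.lam_pos[OF s] by simp
    then show ?thesis
      using cauchy_eq[of "A.angle s"] rA[of s] dirA[of s] s unfolding gap_def \<delta>_def by (simp add: inner_diff_left)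
  qed
  \<comment> \<open>\<open>\<delta>\<close> is orthogonal to \<open>n\<close> on an interval. Since
    \<open>q\<close> does not vanish, \<open>n\<close> turns, so differentiation makes
    \<open>\<delta>\<close> orthogonal to the normal \<open>\<i> * n\<close> as well.\<close>
  have "\<delta> = 0"
  proof (rule ccontr)
    assume nz: "\<delta> \<noteq> 0"
    define s where "s = L / 2"
    have s: "0 < s" "s < L" using A.L_pos unfolding s_def by auto
    have "((\<lambda>s. Re \<delta> * Re (n s) + Im \<delta> * Im (n s)) has_real_derivative
        Re \<delta> * (- A.curv s * Im (n s)) + Im \<delta> * (A.curv s * Re (n s))) (at s)"
      by (intro DERIV_add DERIV_cmult A.dRe_n A.dIm_n s)
    moreover have "((\<lambda>s. Re \<delta> * Re (n s) + Im \<delta> * Im (n s)) has_real_derivative 0) (at s)"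
      by (rule has_field_derivative_transform_within_open[of "\<lambda>_. 0" 0 s "{0<..<L}"])
        (use s orth in \<open>auto simp: inner_complex_def\<close>)
    ultimately have "Re \<delta> * (- A.curv s * Im (n s)) + Im \<delta> * (A.curv s * Re (n s)) = 0"
      using DERIV_unique by blast
    then have "A.curv s * (Im \<delta> * Re (n s) - Re \<delta> * Im (n s)) = 0" by (simp add: algebra_simps)
    moreover have "q s \<noteq> 0" "A.lam s \<noteq> 0" using bspec[OF q, of s] s A.lam_pos[OF s] by auto
    ultimately have "Im \<delta> * Re (n s) - Re \<delta> * Im (n s) = 0" by simp
    moreover have "Re \<delta> * Re (n s) + Im \<delta> * Im (n s) = 0" using orth[OF s] by (simp add: inner_complex_def)
    moreover have "(Im \<delta> * Re (n s) - Re \<delta> * Im (n s))\<^sup>2 + (Re \<delta> * Re (n s) + Im \<delta> * Im (n s))\<^sup>2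
        = (cmod \<delta>)\<^sup>2 * (cmod (n s))\<^sup>2"
      unfolding cmod_power2 by algebra
    ultimately have "(cmod \<delta>)\<^sup>2 * (cmod (n s))\<^sup>2 = 0" by simp
    then show False using nz A.norm_n[of s] s by simp
  qed
  then have p: "p = p'" unfolding \<delta>_def by simp
  moreover have "0 \<le> q 0" "0 \<le> q' 0"
    by (fact A.q_0_nonneg[OF q] B.q_0_nonneg[OF q'])+
  moreover have "(q 0)\<^sup>2 = (q' 0)\<^sup>2"
    using A.energy[of 0] B.energy[of 0] n_ends L p by auto
  ultimately have "q 0 = q' 0" using L by (simp add: power2_eq_iff_nonneg)
  then show ?thesis using coincide_if_equal_momentum p by simp
qed

end

text \<open>The total turn is at most \<open>pi\<close>, so at interior times the angle from the
  initial tangent lies strictly between 0 and \<open>pi\<close> and \<open>n\<close> points to the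
  left of that tangent.\<close>

lemma (in planar_geodesic) left_turn_displacement:
  assumes q: "\<forall>s\<in>{0<..<L}. 0 < q s"
  shows "Im (cnj (n 0) * z 0) < Im (cnj (n 0) * z L)"
proof -
  have "Re (n 0) * Im (z 0) - Im (n 0) * Re (z 0) < Re (n 0) * Im (z L) - Im (n 0) * Re (z L)"
  proof (rule increasing_from_derivative[OF L_pos])
    show "continuous_on {0..L} (\<lambda>s. Re (n 0) * Im (z s) - Im (n 0) * Re (z s))"
      by (intro continuous_intros cont_z)
    show "((\<lambda>s. Re (n 0) * Im (z s) - Im (n 0) * Re (z s)) has_real_derivative
        Re (n 0) * Im (n s) - Im (n 0) * Re (n s)) (at s)" if "0 < s" "s < L" for s
      by (intro DERIV_diff DERIV_cmult dRe_z dIm_z that)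
    show "0 < Re (n 0) * Im (n s) - Im (n 0) * Re (n s)" if s: "0 < s" "s < L" for s
    proof -
      have "Re (n 0) * Im (n s) - Im (n 0) * Re (n s) = ((Re (n 0))\<^sup>2 + (Im (n 0))\<^sup>2) * sin (angle s)"
        using n_eq_cis_angle[of s] s by (simp add: power2_eq_square algebra_simps)
      moreover have "(Re (n 0))\<^sup>2 + (Im (n 0))\<^sup>2 = 1"
        using norm_n[of 0] L_pos cmod_power2[of "n 0"] by simp
      moreover have "0 < sin (angle s)"
        using increasing_angle[OF q, of 0 s] increasing_angle[OF q, of s L] angle_bounds[of L] s
        by (intro sin_gt_zero) auto
      ultimately show ?thesis by simp
    qed
  qed
  then show ?thesis by (simp add: algebra_simps)
qed

context geodesic_pair
begin

interpretation R: geodesic_pair L "cnj p" "\<lambda>s. cnj (z s)" "\<lambda>s. cnj (n s)" "\<lambda>s. - q s"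
    L' "cnj p'" "\<lambda>s. cnj (z' s)" "\<lambda>s. cnj (n' s)" "\<lambda>s. - q' s"
  by (rule reflected)

lemma not_opposite_turns:
  assumes q: "\<forall>s\<in>{0<..<L}. 0 < q s" and q': "\<forall>s\<in>{0<..<L'}. q' s < 0"
  shows False
proof -
  have "Im (cnj (n 0) * z 0) < Im (cnj (n 0) * z L)"
    by (rule A.left_turn_displacement[OF q])
  moreover have "Im (cnj (cnj (n' 0)) * cnj (z' 0)) < Im (cnj (cnj (n' 0)) * cnj (z' L'))"
    by (rule R.B.left_turn_displacement) (use q' in simp)
  ultimately show False using z_ends n_ends by simp
qed

end

context geodesic_pair
begin

interpretation R: geodesic_pair L "cnj p" "\<lambda>s. cnj (z s)" "\<lambda>s. cnj (n s)" "\<lambda>s. - q s"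
    L' "cnj p'" "\<lambda>s. cnj (z' s)" "\<lambda>s. cnj (n' s)" "\<lambda>s. - q' s"
  by (rule reflected)

interpretation S: geodesic_pair L' p' z' n' q' L p z n q
  by (rule swapped)

lemma geodesics_coincide: coincide
proof (rule A.inflection_dichotomy)
  fix s0 assume "0 < s0" "s0 < L" "q s0 = 0"
  then show coincide by (rule coincide_if_inflection)
next
  assume q: "\<forall>s\<in>{0<..<L}. 0 < q s"
  show coincide
  proof (rule B.inflection_dichotomy)
    fix s0 assume "0 < s0" "s0 < L'" "q' s0 = 0"
    then show coincide using S.coincide_if_inflection by auto
  next
    assume "\<forall>s\<in>{0<..<L'}. 0 < q' s"
    then show coincide by (rule coincide_if_both_pos[OF q])
  next
    assume "\<forall>s\<in>{0<..<L'}. q' s < 0"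
    then show coincide using not_opposite_turns[OF q] by blast
  qed
next
  assume q: "\<forall>s\<in>{0<..<L}. q s < 0"
  show coincide
  proof (rule B.inflection_dichotomy)
    fix s0 assume "0 < s0" "s0 < L'" "q' s0 = 0"
    then show coincide using S.coincide_if_inflection by auto
  next
    assume q': "\<forall>s\<in>{0<..<L'}. 0 < q' s"
    have "\<forall>s\<in>{0<..<L}. 0 < - q s" "\<forall>s\<in>{0<..<L'}. - q' s < 0" using q q' by auto
    from R.not_opposite_turns[OF this] show coincide ..
  next
    assume q': "\<forall>s\<in>{0<..<L'}. q' s < 0"
    have "\<forall>s\<in>{0<..<L}. 0 < - q s" "\<forall>s\<in>{0<..<L'}. 0 < - q' s" using q q' by auto
    from R.coincide_if_both_pos[OF this] show coincide by simp
  qed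
qed

end

section \<open>Geodesics in space\<close>

lemma inner_3: "(a :: real^3) \<bullet> b = a $ 1 * b $ 1 + a $ 2 * b $ 2 + a $ 3 * b $ 3"
  by (simp add: inner_vec_def sum_3)

text \<open>\<open>(n \<bullet> m) y - (n \<bullet> y) m\<close> is
  \<open>n \<times> (y \<times> m)\<close>, and the Lagrange identity gives the right-hand side. For
  a unit vector \<open>n\<close> orthogonal to \<open>q\<close> only
  \<open>q \<bullet> (m \<times> y)\<close> is left, which therefore governs the turning of
  \<open>n\<close> from \<open>m\<close> towards \<open>y\<close>.\<close>

lemma cross3_inner_exchange:
  "(cross3 q n \<bullet> y) * (n \<bullet> m) - (cross3 q n \<bullet> m) * (n \<bullet> y)
    = (q \<bullet> cross3 m y) * (n \<bullet> n) - (q \<bullet> n) * (n \<bullet> cross3 m y)"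
  unfolding inner_3 cross3_def vector_3 by algebra

lemma inner_cross3_cross3:
  "cross3 a b \<bullet> cross3 c d = (a \<bullet> c) * (b \<bullet> d) - (a \<bullet> d) * (b \<bullet> c)"
  unfolding inner_3 cross3_def vector_3 by algebra

locale space_geodesic =
  fixes L :: real and p :: "real^3" and x n q :: "real \<Rightarrow> real^3"
  assumes L_pos: "0 < L"
    and cont_x: "continuous_on {0..L} x"
    and cont_n: "continuous_on {0..L} n"
    and cont_q: "continuous_on {0..L} q"
    and norm_n: "\<And>s. 0 \<le> s \<Longrightarrow> s \<le> L \<Longrightarrow> n s \<bullet> n s = 1"
    and torque_perp: "\<And>s. 0 \<le> s \<Longrightarrow> s \<le> L \<Longrightarrow> q s \<bullet> n s = 0"
    and lam_nonneg: "\<And>s. 0 \<le> s \<Longrightarrow> s \<le> L \<Longrightarrow> 0 \<le> p \<bullet> n s"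
    and energy: "\<And>s. 0 \<le> s \<Longrightarrow> s \<le> L \<Longrightarrow> q s \<bullet> q s + (p \<bullet> n s)\<^sup>2 = 1"
    and lam_pos: "\<And>s. 0 < s \<Longrightarrow> s < L \<Longrightarrow> 0 < p \<bullet> n s"
    and dx: "\<And>s. 0 < s \<Longrightarrow> s < L \<Longrightarrow> (x has_vector_derivative n s) (at s)"
    and dn: "\<And>s. 0 < s \<Longrightarrow> s < L \<Longrightarrow>
      (n has_vector_derivative (1 / (p \<bullet> n s)) *\<^sub>R cross3 (q s) (n s)) (at s)"
    and dq: "\<And>s. 0 < s \<Longrightarrow> s < L \<Longrightarrow> (q has_vector_derivative cross3 p (n s)) (at s)"
begin

lemma dx_inner: "0 < s \<Longrightarrow> s < L \<Longrightarrow> ((\<lambda>s. x s \<bullet> v) has_real_derivative n s \<bullet> v) (at s)"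
  using bounded_linear.has_vector_derivative[OF bounded_linear_inner_left dx]
  unfolding has_real_derivative_iff_has_vector_derivative .

lemma dn_inner: "0 < s \<Longrightarrow> s < L \<Longrightarrow>
    ((\<lambda>s. n s \<bullet> v) has_real_derivative (cross3 (q s) (n s) \<bullet> v) / (p \<bullet> n s)) (at s)"
  using bounded_linear.has_vector_derivative[OF bounded_linear_inner_left dn, of s v]
  unfolding has_real_derivative_iff_has_vector_derivative by simp

lemma dq_inner: "0 < s \<Longrightarrow> s < L \<Longrightarrow> ((\<lambda>s. q s \<bullet> v) has_real_derivative cross3 p (n s) \<bullet> v) (at s)"
  using bounded_linear.has_vector_derivative[OF bounded_linear_inner_left dq]
  unfolding has_real_derivative_iff_has_vector_derivative .

text \<open>Where \<open>n \<bullet> y\<close> is negative, the component of \<open>n\<close> along \<open>m = p - (p \<bullet> y) y\<close> is automatically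
  positive. The slope of \<open>n\<close> relative to \<open>m\<close> and \<open>y\<close> would have to return to \<open>0\<close>, although the
  torque that controls its growth is strictly decreasing.\<close>

lemma direction_nonneg:
  assumes y: "y \<bullet> y = 1" "0 \<le> p \<bullet> y" and ends: "n 0 \<bullet> y = 0" "n L \<bullet> y = 0"
    and s: "0 \<le> s" "s \<le> L"
  shows "0 \<le> n s \<bullet> y"
proof (rule ccontr)
  assume "\<not> 0 \<le> n s \<bullet> y"
  then have neg_s: "n s \<bullet> y < 0" by simp
  have cont_N: "continuous_on {0..L} (\<lambda>s. n s \<bullet> y)" by (intro continuous_intros cont_n)
  obtain a b where ab: "0 \<le> a" "a < s" "s < b" "b \<le> L" "n a \<bullet> y = 0" "n b \<bullet> y = 0"
    and neg: "\<And>t. a < t \<Longrightarrow> t < b \<Longrightarrow> n t \<bullet> y < 0"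
    using negative_component[OF cont_N ends, of s] s neg_s by auto
  define m where "m = p - (p \<bullet> y) *\<^sub>R y"
  define \<kappa> where "\<kappa> t = q t \<bullet> cross3 m y" for t
  have nm: "n t \<bullet> m = p \<bullet> n t - (p \<bullet> y) * (n t \<bullet> y)" for t
    unfolding m_def by (simp add: inner_diff_right inner_commute)
  have M_pos: "0 < n t \<bullet> m" if "a < t" "t < b" for t
  proof -
    have "(p \<bullet> y) * (n t \<bullet> y) \<le> 0" using neg[OF that] y(2) by (simp add: mult_nonneg_nonpos)
    then show ?thesis using lam_pos[of t] that ab unfolding nm by auto
  qed
  have my: "m \<bullet> y = 0" unfolding m_def using y(1) by (simp add: inner_diff_left)
  have pm: "p \<bullet> m = m \<bullet> m"
    using my unfolding m_def by (simp add: inner_diff_left inner_diff_right inner_commute)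
  have pm_pos: "0 < p \<bullet> m"
    unfolding pm using M_pos[OF ab(2,3)] by auto
  have kappa_eq: "\<kappa> t = (cross3 (q t) (n t) \<bullet> y) * (n t \<bullet> m) - (cross3 (q t) (n t) \<bullet> m) * (n t \<bullet> y)"
    if "0 \<le> t" "t \<le> L" for t
    unfolding \<kappa>_def cross3_inner_exchange using norm_n[OF that] torque_perp[OF that] by simp
  have cont_kappa: "continuous_on {0..L} \<kappa>"
    unfolding \<kappa>_def by (intro continuous_intros cont_q)
  \<comment> \<open>The derivative \<open>(p \<times> n) \<bullet> (m \<times> y)\<close> splits by
    the Lagrange identity. The first term is negative since
    \<open>p \<bullet> m = m \<bullet> m > 0\<close> and \<open>n \<bullet> y < 0\<close>; the
    second is subtracted and nonnegative.\<close>
  have decr: "\<kappa> b < \<kappa> a"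
  proof (rule decreasing_from_derivative[of a b \<kappa>])
    show "a < b" using ab by simp
    show "continuous_on {a..b} \<kappa>" using continuous_on_subset[OF cont_kappa] ab by auto
    fix t assume t: "a < t" "t < b"
    then show "(\<kappa> has_real_derivative (p \<bullet> m) * (n t \<bullet> y) - (p \<bullet> y) * (n t \<bullet> m)) (at t)"
      using dq_inner[of t "cross3 m y"] ab unfolding \<kappa>_def inner_cross3_cross3 by simp
    show "(p \<bullet> m) * (n t \<bullet> y) - (p \<bullet> y) * (n t \<bullet> m) < 0"
      using mult_pos_neg[OF pm_pos neg[OF t]] mult_nonneg_nonneg[OF y(2) less_imp_le[OF M_pos[OF t]]] by simp
  qed
  define w where "w t = (n t \<bullet> y) / (n t \<bullet> m)" for t
  define w' where "w' t = \<kappa> t / ((p \<bullet> n t) * (n t \<bullet> m)\<^sup>2)" for t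
  have dw: "(w has_real_derivative w' t) (at t)" if t: "a < t" "t < b" for t
  proof -
    have t': "0 < t" "t < L" using t ab by auto
    have "(w has_real_derivative ((cross3 (q t) (n t) \<bullet> y) / (p \<bullet> n t) * (n t \<bullet> m)
        - (n t \<bullet> y) * ((cross3 (q t) (n t) \<bullet> m) / (p \<bullet> n t))) / ((n t \<bullet> m) * (n t \<bullet> m))) (at t)"
      unfolding w_def by (intro DERIV_divide dn_inner t') (use M_pos[OF t] in simp)
    moreover have "((cross3 (q t) (n t) \<bullet> y) / (p \<bullet> n t) * (n t \<bullet> m)
        - (n t \<bullet> y) * ((cross3 (q t) (n t) \<bullet> m) / (p \<bullet> n t))) / ((n t \<bullet> m) * (n t \<bullet> m)) = w' t"
      unfolding w'_def kappa_eq[OF less_imp_le[OF t'(1)] less_imp_le[OF t'(2)]]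
      using lam_pos[OF t'] M_pos[OF t] by (simp add: power2_eq_square divide_simps)
    ultimately show ?thesis by simp
  qed
  have w'_sign: "0 < \<kappa> t \<Longrightarrow> 0 < w' t" "\<kappa> t < 0 \<Longrightarrow> w' t < 0" if t: "a < t" "t < b" for t
    using lam_pos[of t] M_pos[OF t] t ab unfolding w'_def by (simp_all add: divide_neg_pos)
  have w_neg: "w t < 0" if "a < t" "t < b" for t
    unfolding w_def using neg[OF that] M_pos[OF that] by (simp add: divide_neg_pos)
  \<comment> \<open>At an end of the interval with \<open>n \<bullet> m = 0\<close> the quotient
    \<open>w\<close> has the form 0/0 and is of no help, but there both terms of
    \<open>kappa_eq\<close> vanish, which is already enough for the sign claims.\<close>
  have kappa_at_cusp: "\<kappa> t = 0" if "0 \<le> t" "t \<le> L" "n t \<bullet> y = 0" "n t \<bullet> m \<le> 0" for t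
  proof -
    have "n t \<bullet> m = 0" using that lam_nonneg[of t] unfolding nm by simp
    then show ?thesis using kappa_eq[of t] that by simp
  qed
  have cont_w: "continuous_on {c..d} w" if "a \<le> c" "d \<le> b" "\<And>t. c \<le> t \<Longrightarrow> t \<le> d \<Longrightarrow> n t \<bullet> m \<noteq> 0" for c d
    unfolding w_def using that continuous_on_subset[OF cont_n, of "{c..d}"] ab
    by (intro continuous_intros) auto
  have "\<kappa> a \<le> 0"
  proof (rule ccontr)
    assume pos: "\<not> \<kappa> a \<le> 0"
    then have Ma: "0 < n a \<bullet> m" using kappa_at_cusp[of a] ab by force
    have "0 < \<kappa> a" "a \<in> {0..L}" using pos ab by auto
    then obtain e where e: "0 < e" "\<And>t. t \<in> {0..L} \<Longrightarrow> \<bar>t - a\<bar> < e \<Longrightarrow> 0 < \<kappa> t"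
      using eventually_positive_near[OF cont_kappa] by metis
    have "\<exists>t. a < t \<and> t < s \<and> 0 < w t"
    proof (rule positive_right_of_zero[OF ab(2) _ _ dw e(1) w'_sign(1)])
      show "continuous_on {a..s} w"
      proof (rule cont_w)
        show "n t \<bullet> m \<noteq> 0" if "a \<le> t" "t \<le> s" for t
          using M_pos[of t] Ma that ab by (cases "t = a") auto
      qed (use ab in auto)
      show "w a = 0" unfolding w_def using ab by simp
    qed (use e ab in auto)
    then show False using w_neg ab by (meson less_trans less_asym)
  qed
  moreover have "0 \<le> \<kappa> b"
  proof (rule ccontr)
    assume neg_b: "\<not> 0 \<le> \<kappa> b"
    then have Mb: "0 < n b \<bullet> m" using kappa_at_cusp[of b] ab by force
    have "0 < - \<kappa> b" "b \<in> {0..L}" using neg_b ab by auto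
    then obtain e where e: "0 < e" "\<And>t. t \<in> {0..L} \<Longrightarrow> \<bar>t - b\<bar> < e \<Longrightarrow> 0 < - \<kappa> t"
      using eventually_positive_near[OF continuous_on_minus[OF cont_kappa]] by metis
    have "\<exists>t. s < t \<and> t < b \<and> 0 < w t"
    proof (rule positive_left_of_zero[OF ab(3) _ _ dw e(1) w'_sign(2)])
      show "continuous_on {s..b} w"
      proof (rule cont_w)
        show "n t \<bullet> m \<noteq> 0" if "s \<le> t" "t \<le> b" for t
          using M_pos[of t] Mb that ab by (cases "t = b") auto
      qed (use ab in auto)
      show "w b = 0" unfolding w_def using ab by simp
      show "\<kappa> t < 0" if "s < t" "t < b" "\<bar>t - b\<bar> < e" for t using e(2)[of t] that ab by auto
    qed (use ab in auto)
    then show False using w_neg ab by (meson less_trans less_asym)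
  qed
  ultimately show False using decr by simp
qed

lemma direction_planar_aux:
  assumes y: "y \<bullet> y = 1" "0 \<le> p \<bullet> y" and ends: "n 0 \<bullet> y = 0" "n L \<bullet> y = 0" "x L \<bullet> y = x 0 \<bullet> y"
    and s: "0 \<le> s" "s \<le> L"
  shows "x s \<bullet> y = x 0 \<bullet> y"
proof -
  have mono: "x a \<bullet> y \<le> x b \<bullet> y" if "0 \<le> a" "a \<le> b" "b \<le> L" for a b
  proof (rule DERIV_nonneg_imp_increasing_open[OF that(2)])
    show "\<exists>d. ((\<lambda>s. x s \<bullet> y) has_real_derivative d) (at t) \<and> 0 \<le> d" if t: "a < t" "t < b" for t
      using dx_inner[of t y] direction_nonneg[OF y ends(1,2), of t] t \<open>0 \<le> a\<close> \<open>b \<le> L\<close> by auto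
    show "continuous_on {a..b} (\<lambda>s. x s \<bullet> y)"
      using continuous_on_subset[OF cont_x, of "{a..b}"] that by (auto intro!: continuous_intros)
  qed
  show ?thesis using mono[of 0 s] mono[of s L] ends(3) s by auto
qed

lemma position_planar:
  assumes y: "y \<bullet> y = 1" and ends: "n 0 \<bullet> y = 0" "n L \<bullet> y = 0" "x L \<bullet> y = x 0 \<bullet> y"
    and s: "0 \<le> s" "s \<le> L"
  shows "x s \<bullet> y = x 0 \<bullet> y"
proof (cases "0 \<le> p \<bullet> y")
  case False
  then show ?thesis using direction_planar_aux[of "- y" s] assms by simp
qed (use direction_planar_aux assms in blast)

lemma zero_on_closure:
  assumes "continuous_on {0..L} f" "\<And>s. 0 < s \<Longrightarrow> s < L \<Longrightarrow> f s = (0::real)" "0 \<le> s" "s \<le> L"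
  shows "f s = 0"
  using continuous_constant_on_closure[of "{0<..<L}" f 0 s] assms L_pos by simp

text \<open>The constant \<open>x \<bullet> y\<close> is differentiated twice in the interior;
  continuity extends both results to the ends, which may be cusps.\<close>

lemma direction_planar:
  assumes y: "y \<bullet> y = 1" and ends: "n 0 \<bullet> y = 0" "n L \<bullet> y = 0" "x L \<bullet> y = x 0 \<bullet> y"
    and s: "0 \<le> s" "s \<le> L"
  shows "n s \<bullet> y = 0" "cross3 (q s) (n s) \<bullet> y = 0"
proof -
  have 1: "n t \<bullet> y = 0" if t: "0 < t" "t < L" for t
  proof -
    have "((\<lambda>s. x s \<bullet> y) has_real_derivative 0) (at t)"
    proof (rule has_field_derivative_transform_within_open[of "\<lambda>_. x 0 \<bullet> y" 0 t "{0<..<L}"])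
      show "x 0 \<bullet> y = x u \<bullet> y" if "u \<in> {0<..<L}" for u
        using position_planar[OF y ends, of u] that by simp
    qed (use t in auto)
    then show ?thesis using dx_inner[OF t] DERIV_unique by blast
  qed
  show "n s \<bullet> y = 0"
    by (rule zero_on_closure[OF _ 1 s]) (intro continuous_intros cont_n)
  have 2: "cross3 (q t) (n t) \<bullet> y = 0" if t: "0 < t" "t < L" for t
  proof -
    have "((\<lambda>s. n s \<bullet> y) has_real_derivative 0) (at t)"
    proof (rule has_field_derivative_transform_within_open[of "\<lambda>_. 0" 0 t "{0<..<L}"])
      show "0 = n u \<bullet> y" if "u \<in> {0<..<L}" for u using 1[of u] that by simp
    qed (use t in auto)
    then have "(cross3 (q t) (n t) \<bullet> y) / (p \<bullet> n t) = 0" using dn_inner[OF t] DERIV_unique by blast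
    then show ?thesis using lam_pos[OF t] by simp
  qed
  show "cross3 (q s) (n s) \<bullet> y = 0"
    by (rule zero_on_closure[OF _ 2 s])
      (unfold inner_3 cross3_def vector_3, intro continuous_intros cont_n cont_q)
qed

end

text \<open>For a unit vector \<open>y\<close> orthogonal to \<open>e_z\<close>, the vectors
  \<open>e_z\<close>, \<open>y \<times> e_z\<close>, \<open>y\<close> form a positively oriented
  orthonormal basis. The initial direction becomes 1, and the \<open>y\<close>-component of a cross
  product becomes a planar determinant.\<close>

definition plane_coord :: "real^3 \<Rightarrow> real^3 \<Rightarrow> complex" where
  "plane_coord y v = Complex (v \<bullet> e_z) (v \<bullet> cross3 y e_z)"

lemma e_z_nth [simp]: "e_z $ 1 = 0" "e_z $ 2 = 0" "e_z $ 3 = 1"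
  unfolding e_z_def by simp_all

lemma bounded_linear_plane_coord: "bounded_linear (plane_coord y)"
proof -
  have "linear (plane_coord y)"
    by (rule linearI) (simp_all add: plane_coord_def complex_eq_iff inner_add_left)
  then show ?thesis by (simp add: linear_conv_bounded_linear)
qed

locale plane_frame =
  fixes y :: "real^3"
  assumes unit: "y \<bullet> y = 1" and perp: "e_z \<bullet> y = 0"
begin

lemma y_nth: "y $ 3 = 0" "(y $ 1)\<^sup>2 + (y $ 2)\<^sup>2 = 1"
  using unit perp unfolding inner_3 by (simp_all add: power2_eq_square)

lemma inner_frame: "a \<bullet> b = plane_coord y a \<bullet> plane_coord y b + (a \<bullet> y) * (b \<bullet> y)"
  using y_nth unfolding plane_coord_def inner_complex_def complex.sel inner_3 cross3_def vector_3 e_z_nth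
  by algebra

lemma cross_frame: "cross3 a b \<bullet> y = Im (cnj (plane_coord y a) * plane_coord y b)"
  using y_nth unfolding plane_coord_def inner_3 cross3_def vector_3 e_z_nth
  by (simp add: algebra_simps)

lemma plane_coord_cross:
  assumes "b \<bullet> y = 0"
  shows "plane_coord y (cross3 a b) = \<i> * complex_of_real (a \<bullet> y) * plane_coord y b"
proof -
  have "cross3 a b \<bullet> e_z = - (a \<bullet> y) * (b \<bullet> cross3 y e_z)"
    "cross3 a b \<bullet> cross3 y e_z = (a \<bullet> y) * (b \<bullet> e_z)"
    using y_nth assms unfolding inner_3 cross3_def vector_3 e_z_nth by algebra+
  then show ?thesis by (simp add: plane_coord_def complex_eq_iff)
qed

lemma plane_coord_inject:
  assumes "plane_coord y a = plane_coord y b" "a \<bullet> y = b \<bullet> y" shows "a = b"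
proof -
  have "(a - b) \<bullet> (a - b) = 0"
    using assms inner_frame[of "a - b" "a - b"]
    by (simp add: plane_coord_def inner_diff_left complex_eq_iff inner_complex_def)
  then show ?thesis by simp
qed

lemma coplanar_of_perp:
  assumes "\<And>v. v \<in> S \<Longrightarrow> v \<bullet> y = 0" shows "coplanar S"
  unfolding coplanar_def
proof (intro exI subsetI)
  fix v assume v: "v \<in> S"
  let ?a = "v \<bullet> e_z" and ?b = "v \<bullet> cross3 y e_z"
  have pc: "plane_coord y e_z = 1" "plane_coord y (cross3 y e_z) = \<i>" "cross3 y e_z \<bullet> y = 0"
    using y_nth unfolding plane_coord_def complex_eq_iff inner_3 cross3_def vector_3 e_z_nth
    by (simp_all add: power2_eq_square)
  have "v = ?a *\<^sub>R e_z + ?b *\<^sub>R cross3 y e_z"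
  proof (rule plane_coord_inject)
    show "plane_coord y v = plane_coord y (?a *\<^sub>R e_z + ?b *\<^sub>R cross3 y e_z)"
      unfolding linear_add[OF bounded_linear.linear[OF bounded_linear_plane_coord]]
        linear_scale[OF bounded_linear.linear[OF bounded_linear_plane_coord]] pc
      by (simp add: plane_coord_def complex_eq_iff)
    show "v \<bullet> y = (?a *\<^sub>R e_z + ?b *\<^sub>R cross3 y e_z) \<bullet> y"
      using assms[OF v] perp pc(3) by (simp add: inner_add_left)
  qed
  then have "v = (1 - ?a - ?b) *\<^sub>R 0 + ?a *\<^sub>R e_z + ?b *\<^sub>R cross3 y e_z" by simp
  then show "v \<in> affine hull {0, e_z, cross3 y e_z}"
    unfolding affine_hull_3 by (intro CollectI exI[of _ "1 - ?a - ?b"] exI[of _ ?a] exI[of _ ?b]) simp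
qed

end

text \<open>The torque becomes a scalar: its part in the plane is orthogonal to \<open>n\<close>
  and, since \<open>(q \<times> n) \<bullet> y = 0\<close>, also parallel to \<open>n\<close>, hence
  0. The momentum enters only through \<open>p \<bullet> n\<close> and
  \<open>(p \<times> n) \<bullet> y\<close>, which its projection to the plane determines.\<close>

lemma (in space_geodesic) planar_geodesic_of_planar:
  assumes "plane_frame y" and ends: "n 0 \<bullet> y = 0" "n L \<bullet> y = 0" "x L \<bullet> y = x 0 \<bullet> y"
  shows "planar_geodesic L (plane_coord y p) (\<lambda>s. plane_coord y (x s)) (\<lambda>s. plane_coord y (n s)) (\<lambda>s. q s \<bullet> y)"
proof -
  interpret plane_frame y by fact
  note bl = bounded_linear.has_vector_derivative[OF bounded_linear_plane_coord]
  note cont = bounded_linear.continuous_on[OF bounded_linear_plane_coord]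
  have ny: "n s \<bullet> y = 0" if "0 \<le> s" "s \<le> L" for s using direction_planar(1)[OF unit ends that] .
  have lam: "plane_coord y p \<bullet> plane_coord y (n s) = p \<bullet> n s" if "0 \<le> s" "s \<le> L" for s
    using inner_frame[of p "n s"] ny[OF that] by simp
  have nn: "plane_coord y (n s) \<bullet> plane_coord y (n s) = 1" if "0 \<le> s" "s \<le> L" for s
    using inner_frame[of "n s" "n s"] ny[OF that] norm_n[OF that] by simp
  have q0: "plane_coord y (q s) = 0" if s: "0 \<le> s" "s \<le> L" for s
  proof -
    have "Re (cnj (plane_coord y (q s)) * plane_coord y (n s)) = 0"
      using inner_frame[of "q s" "n s"] ny[OF s] torque_perp[OF s] by (simp add: inner_complex_def)
    moreover have "Im (cnj (plane_coord y (q s)) * plane_coord y (n s)) = 0"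
      using cross_frame[of "q s" "n s"] direction_planar(2)[OF unit ends s] by simp
    ultimately have "cnj (plane_coord y (q s)) * plane_coord y (n s) = 0"
      by (simp only: complex_eq_iff) simp
    moreover have "plane_coord y (n s) \<noteq> 0" using nn[OF s] by auto
    ultimately show ?thesis by simp
  qed
  show ?thesis
  proof
    show "0 < L" by (rule L_pos)
    show "continuous_on {0..L} (\<lambda>s. plane_coord y (x s))" "continuous_on {0..L} (\<lambda>s. plane_coord y (n s))"
      by (rule cont[OF cont_x] cont[OF cont_n])+
    show "continuous_on {0..L} (\<lambda>s. q s \<bullet> y)" by (intro continuous_intros cont_q)
    show "cmod (plane_coord y (n s)) = 1" if "0 \<le> s" "s \<le> L" for s
      using nn[OF that] by (simp add: norm_eq_sqrt_inner)
    show "0 \<le> plane_coord y p \<bullet> plane_coord y (n s)" if "0 \<le> s" "s \<le> L" for s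
      unfolding lam[OF that] using lam_nonneg[OF that] .
    show "(q s \<bullet> y)\<^sup>2 + (plane_coord y p \<bullet> plane_coord y (n s))\<^sup>2 = 1" if "0 \<le> s" "s \<le> L" for s
      unfolding lam[OF that] using energy[OF that] inner_frame[of "q s" "q s"] q0[OF that]
      by (simp add: power2_eq_square)
    fix s assume s: "0 < s" "s < L"
    then have s': "0 \<le> s" "s \<le> L" by auto
    show "0 < plane_coord y p \<bullet> plane_coord y (n s)" unfolding lam[OF s'] using lam_pos[OF s] .
    show "((\<lambda>s. plane_coord y (x s)) has_vector_derivative plane_coord y (n s)) (at s)"
      by (rule bl[OF dx[OF s]])
    have "plane_coord y ((1 / (p \<bullet> n s)) *\<^sub>R cross3 (q s) (n s))
        = \<i> * complex_of_real (q s \<bullet> y / (p \<bullet> n s)) * plane_coord y (n s)"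
      unfolding linear_scale[OF bounded_linear.linear[OF bounded_linear_plane_coord]] plane_coord_cross[OF ny[OF s']]
      by (simp add: scaleR_conv_of_real)
    from this[symmetric] show "((\<lambda>s. plane_coord y (n s)) has_vector_derivative
        \<i> * complex_of_real (q s \<bullet> y / (plane_coord y p \<bullet> plane_coord y (n s))) * plane_coord y (n s)) (at s)"
      unfolding lam[OF s'] by (simp only: bl[OF dn[OF s]])
    show "((\<lambda>s. q s \<bullet> y) has_real_derivative Im (cnj (plane_coord y p) * plane_coord y (n s))) (at s)"
      unfolding cross_frame[symmetric] by (rule dq_inner[OF s])
  qed
qed

section \<open>From the moving frame to the spatial frame\<close>

lemma vector_3_expand: "(vector [a, b, c] :: real^3) = a *\<^sub>R axis 1 1 + b *\<^sub>R axis 2 1 + c *\<^sub>R axis 3 1"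
  by (simp add: vec_eq_iff forall_3 axis_def)

lemma has_vector_derivative_vector_3:
  assumes "(f has_real_derivative f') (at s)" "(g has_real_derivative g') (at s)" "(h has_real_derivative h') (at s)"
  shows "((\<lambda>s. vector [f s, g s, h s] :: real^3) has_vector_derivative vector [f', g', h']) (at s)"
  using assms unfolding vector_3_expand by (auto intro!: derivative_eq_intros)

lemma bounded_bilinear_matrix_vector: "bounded_bilinear ((*v) :: real^3^3 \<Rightarrow> real^3 \<Rightarrow> real^3)"
  unfolding bilinear_conv_bounded_bilinear[symmetric] bilinear_def
  by (auto intro!: linearI simp: matrix_vector_right_distrib matrix_vector_mult_add_rdistrib
      scaleR_matrix_vector_assoc[symmetric] matrix_vector_mult_scaleR)

lemma rotation_inner:
  fixes A :: "real^3^3"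
  assumes "rotation_matrix A" shows "(A *v a) \<bullet> (A *v b) = a \<bullet> b"
proof -
  have "orthogonal_matrix A" using assms unfolding rotation_matrix_def by simp
  then have "orthogonal_transformation ((*v) A)"
    using orthogonal_transformation_matrix[of "(*v) A"] matrix_vector_mul_linear[of A] by simp
  then show ?thesis by (simp add: orthogonal_transformation_def)
qed

text \<open>\<open>rotation_generator a b\<close> is the matrix of the cross product with
  \<open>(a, b, 0)\<close>, so in the moving frame the angular velocity is \<open>Q / lam3\<close>
  with \<open>Q = (lam4, lam5, 0)\<close>. For \<open>P = (lam1, lam2, lam3)\<close> the momentum
  formulas give \<open>P' + (Q / lam3) \<times> P = 0\<close> and
  \<open>Q' = P \<times> e_z\<close>. Hence \<open>R P\<close> is constant, and as \<open>Q\<close>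
  is parallel to the angular velocity, the derivative of \<open>R Q\<close> is
  \<open>R (P \<times> e_z)\<close>.\<close>

lemma space_geodesic_of_cuspless:
  assumes cg: "cuspless_geodesic l1 l2 l4 l5 x R" and L: "0 < L" "ereal L \<le> s_max l1 l2 l4 l5"
  shows "space_geodesic L (vector [l1, l2, lam3 l1 l2 l4 l5 0]) x (\<lambda>s. R s *v e_z)
    (\<lambda>s. R s *v vector [lam4 l2 l4 s, lam5 l1 l5 s, 0])"
proof -
  define f1 f2 f3 f4 f5 where "f1 = lam1 l1 l5" and "f2 = lam2 l2 l4" and "f3 = lam3 l1 l2 l4 l5"
    and "f4 = lam4 l2 l4" and "f5 = lam5 l1 l5"
  note fs = this
  have dom: "s \<in> geodesic_domain l1 l2 l4 l5" if "0 \<le> s" "s \<le> L" for s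
    using that L(2) order_trans[of "ereal s" "ereal L"] unfolding geodesic_domain_def by simp
  have inner_dom: "ereal s < s_max l1 l2 l4 l5" if "s < L" for s
    using that L(2) by (meson ereal_less_eq(3) less_ereal.simps(1) less_le_trans)
  have adm: "(f4 s)\<^sup>2 + (f5 s)\<^sup>2 \<le> 1" if "0 \<le> s" "s \<le> L" for s
    using cg dom[OF that] unfolding cuspless_geodesic_def admissible_momentum_def fs by blast
  have f3_sq: "(f3 s)\<^sup>2 = 1 - (f4 s)\<^sup>2 - (f5 s)\<^sup>2" and f3_nonneg: "0 \<le> f3 s" if "0 \<le> s" "s \<le> L" for s
    using adm[OF that] unfolding fs lam3_def by simp_all
  \<comment> \<open>A zero before \<open>L\<close> would lie strictly below the infimum that defines
    \<open>s_max\<close>.\<close>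
  have f3_pos: "0 < f3 s" if "0 < s" "s < L" for s
  proof -
    have "f3 s \<noteq> 0"
    proof
      assume "f3 s = 0"
      then have "s_max l1 l2 l4 l5 \<le> ereal s"
        using that unfolding s_max_def fs by (intro Inf_lower) auto
      then show False using inner_dom[OF that(2)] by simp
    qed
    then show ?thesis using f3_nonneg[of s] that by simp
  qed
  have rot: "rotation_matrix (R s)" if "0 \<le> s" "s \<le> L" for s
    using cg dom[OF that] unfolding cuspless_geodesic_def by blast
  have sub: "{0..L} \<subseteq> geodesic_domain l1 l2 l4 l5" using dom by auto
  have cx: "continuous_on {0..L} x" and cR: "continuous_on {0..L} R"
    using cg continuous_on_subset[OF _ sub] unfolding cuspless_geodesic_def by blast+
  have R0: "R 0 = mat 1" using cg unfolding cuspless_geodesic_def by blast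
  have dx: "(x has_vector_derivative R s *v e_z) (at s)"
    and dR: "(R has_vector_derivative (1 / f3 s) *\<^sub>R (R s ** rotation_generator (f4 s) (f5 s))) (at s)"
    if "0 < s" "s < L" for s
    using cg that inner_dom[OF that(2)] unfolding cuspless_geodesic_def fs by blast+
  have df: "(f1 has_real_derivative - f5 s) (at s)" "(f2 has_real_derivative f4 s) (at s)"
    "(f4 has_real_derivative f2 s) (at s)" "(f5 has_real_derivative - f1 s) (at s)" for s
    unfolding fs lam1_def lam2_def lam4_def lam5_def by (auto intro!: derivative_eq_intros)
  have df3: "(f3 has_real_derivative (f5 s * f1 s - f4 s * f2 s) / f3 s) (at s)" if s: "0 < s" "s < L" for s
  proof -
    have f3: "f3 = (\<lambda>s. sqrt (1 - (f4 s)\<^sup>2 - (f5 s)\<^sup>2))" unfolding fs lam3_def ..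
    have pos: "0 < 1 - (f4 s)\<^sup>2 - (f5 s)\<^sup>2" using f3_pos[OF s] unfolding f3 by simp
    have "((\<lambda>s. 1 - (f4 s)\<^sup>2 - (f5 s)\<^sup>2) has_real_derivative 2 * (f5 s * f1 s - f4 s * f2 s)) (at s)"
      by (auto intro!: derivative_eq_intros df)
    from DERIV_chain2[OF DERIV_real_sqrt[OF pos] this]
    have "(f3 has_real_derivative inverse (sqrt (1 - (f4 s)\<^sup>2 - (f5 s)\<^sup>2)) / 2
        * (2 * (f5 s * f1 s - f4 s * f2 s))) (at s)"
      unfolding f3 .
    moreover have "sqrt (1 - (f4 s)\<^sup>2 - (f5 s)\<^sup>2) = f3 s" unfolding f3 ..
    moreover have "inverse (f3 s) / 2 * (2 * (f5 s * f1 s - f4 s * f2 s)) = (f5 s * f1 s - f4 s * f2 s) / f3 s"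
      using f3_pos[OF s] by (simp add: field_simps)
    ultimately show ?thesis by (simp only:)
  qed
  \<comment> \<open>The transport rule of a rotating frame: \<open>W\<close> is \<open>V'\<close>
    plus the angular velocity times \<open>V\<close>. It is applied to \<open>P\<close>,
    \<open>Q\<close> and the constant \<open>e_z\<close>.\<close>
  have dRv: "((\<lambda>s. R s *v V s) has_vector_derivative R s *v W) (at s)"
    if s: "0 < s" "s < L" and V: "(V has_vector_derivative V') (at s)"
      and W: "V' + (1 / f3 s) *\<^sub>R (rotation_generator (f4 s) (f5 s) *v V s) = W" for V V' W s
  proof -
    have "((\<lambda>s. R s *v V s) has_vector_derivative
      R s *v V' + ((1 / f3 s) *\<^sub>R (R s ** rotation_generator (f4 s) (f5 s))) *v V s) (at s)"
      by (rule bounded_bilinear.has_vector_derivative[OF bounded_bilinear_matrix_vector dR[OF s] V])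
    moreover have "R s *v V' + ((1 / f3 s) *\<^sub>R (R s ** rotation_generator (f4 s) (f5 s))) *v V s = R s *v W"
      unfolding W[symmetric]
      by (simp add: matrix_vector_right_distrib scaleR_matrix_vector_assoc[symmetric]
          matrix_vector_mult_scaleR matrix_vector_mul_assoc)
    ultimately show ?thesis by simp
  qed
  define P where "P s = (vector [f1 s, f2 s, f3 s] :: real^3)" for s
  define Q where "Q s = (vector [f4 s, f5 s, 0] :: real^3)" for s
  have gen: "rotation_generator a b *v v = vector [b * v $ 3, - a * v $ 3, a * v $ 2 - b * v $ 1]" for a b v
    unfolding rotation_generator_def by (simp add: vec_eq_iff forall_3 matrix_vector_mult_def sum_3)
  have cf: "continuous_on S f1" "continuous_on S f2" "continuous_on S f4" "continuous_on S f5" for S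
    using df by (meson DERIV_continuous_on has_field_derivative_at_within)+
  have cf3: "continuous_on S f3" for S
    using cf[of S] unfolding fs lam3_def by (intro continuous_intros)
  have cRv: "continuous_on {0..L} (\<lambda>s. R s *v V s)" if "continuous_on {0..L} V" for V
    by (rule bounded_bilinear.continuous_on[OF bounded_bilinear_matrix_vector cR that])
  have cP: "continuous_on {0..L} P" and cQ: "continuous_on {0..L} Q"
    unfolding P_def Q_def vector_3_expand by (intro continuous_intros cf cf3)+
  have P_const: "R s *v P s = P 0" if s: "0 \<le> s" "s \<le> L" for s
  proof -
    have d0: "((\<lambda>s. R s *v P s) has_vector_derivative R t *v 0) (at t)" if t: "0 < t" "t < L" for t
    proof (rule dRv[OF t])
      show "(P has_vector_derivative vector [- f5 t, f4 t, (f5 t * f1 t - f4 t * f2 t) / f3 t]) (at t)"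
        unfolding P_def by (intro has_vector_derivative_vector_3 df df3 t)
      show "vector [- f5 t, f4 t, (f5 t * f1 t - f4 t * f2 t) / f3 t]
          + (1 / f3 t) *\<^sub>R (rotation_generator (f4 t) (f5 t) *v P t) = 0"
        using f3_pos[OF t] unfolding gen P_def by (simp add: vec_eq_iff forall_3 field_simps)
    qed
    have "R s *v P s = R 0 *v P 0"
    proof (cases "s = 0")
      case False
      have "((\<lambda>_. 0) has_integral (R s *v P s - R 0 *v P 0)) {0..s}"
      proof (rule fundamental_theorem_of_calculus_interior)
        show "continuous_on {0..s} (\<lambda>s. R s *v P s)"
          using continuous_on_subset[OF cRv[OF cP]] s by auto
        show "((\<lambda>s. R s *v P s) has_vector_derivative 0) (at t)" if "t \<in> {0<..<s}" for t
          using d0[of t] that s by simp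
      qed (use s in simp)
      then show ?thesis using has_integral_unique[OF has_integral_0] by fastforce
    qed simp
    then show ?thesis unfolding R0 by simp
  qed
  have lam: "P 0 \<bullet> (R s *v e_z) = f3 s" if s: "0 \<le> s" "s \<le> L" for s
  proof -
    have "P 0 \<bullet> (R s *v e_z) = P s \<bullet> e_z"
      unfolding P_const[OF s, symmetric] by (rule rotation_inner[OF rot[OF s]])
    then show ?thesis unfolding P_def inner_3 by simp
  qed
  have P0: "P 0 = vector [l1, l2, lam3 l1 l2 l4 l5 0]"
    unfolding P_def fs lam1_def lam2_def by simp
  have "space_geodesic L (P 0) x (\<lambda>s. R s *v e_z) (\<lambda>s. R s *v Q s)"
  proof
    show "0 < L" "continuous_on {0..L} x" by fact+
    show "continuous_on {0..L} (\<lambda>s. R s *v e_z)" "continuous_on {0..L} (\<lambda>s. R s *v Q s)"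
      by (intro cRv cQ continuous_on_const)+
    fix s
    show "(x has_vector_derivative R s *v e_z) (at s)" if "0 < s" "s < L" by (rule dx[OF that])
    show "(R s *v e_z) \<bullet> (R s *v e_z) = 1" "(R s *v Q s) \<bullet> (R s *v e_z) = 0"
      "0 \<le> P 0 \<bullet> (R s *v e_z)" "(R s *v Q s) \<bullet> (R s *v Q s) + (P 0 \<bullet> (R s *v e_z))\<^sup>2 = 1"
      if s: "0 \<le> s" "s \<le> L"
      unfolding lam[OF s] rotation_inner[OF rot[OF s]] f3_sq[OF s]
      using f3_nonneg[OF s] unfolding Q_def inner_3 by (simp_all add: power2_eq_square)
    assume s: "0 < s" "s < L"
    then have s': "0 \<le> s" "s \<le> L" by auto
    show "0 < P 0 \<bullet> (R s *v e_z)" unfolding lam[OF s'] using f3_pos[OF s] .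
    show "((\<lambda>s. R s *v e_z) has_vector_derivative
        (1 / (P 0 \<bullet> (R s *v e_z))) *\<^sub>R cross3 (R s *v Q s) (R s *v e_z)) (at s)"
      unfolding lam[OF s'] cross_rotation_matrix[OF rot[OF s']] matrix_vector_mult_scaleR[symmetric]
      by (rule dRv[OF s has_vector_derivative_const])
        (simp add: gen Q_def cross3_def vec_eq_iff forall_3)
    have "((\<lambda>s. R s *v Q s) has_vector_derivative R s *v cross3 (P s) e_z) (at s)"
    proof (rule dRv[OF s])
      show "(Q has_vector_derivative vector [f2 s, - f1 s, 0]) (at s)"
        unfolding Q_def by (intro has_vector_derivative_vector_3 df DERIV_const)
      show "vector [f2 s, - f1 s, 0] + (1 / f3 s) *\<^sub>R (rotation_generator (f4 s) (f5 s) *v Q s) = cross3 (P s) e_z"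
        unfolding gen P_def Q_def cross3_def by (simp add: vec_eq_iff forall_3)
    qed
    then show "((\<lambda>s. R s *v Q s) has_vector_derivative cross3 (P 0) (R s *v e_z)) (at s)"
      unfolding cross_rotation_matrix[OF rot[OF s'], symmetric] P_const[OF s'] .
  qed
  then show ?thesis unfolding P0 Q_def fs .
qed

text \<open>The equation for \<open>x\<close> is given in the interior only. As \<open>n\<close> is
  continuous on the closed interval, \<open>x\<close> is an integral of \<open>n\<close>, which
  yields the one-sided derivatives that define the end directions.\<close>

lemma (in space_geodesic) derivative_at_ends:
  assumes "0 \<le> s" "s \<le> L"
  shows "(x has_vector_derivative n s) (at s within {0..L})"
proof -
  have "integral {0..t} n = x t - x 0" if "t \<in> {0..L}" for t
  proof (rule integral_unique, rule fundamental_theorem_of_calculus_interior)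
    show "continuous_on {0..t} x" using continuous_on_subset[OF cont_x] that by auto
    show "(x has_vector_derivative n u) (at u)" if "u \<in> {0<..<t}" for u
      using dx[of u] that \<open>t \<in> {0..L}\<close> by auto
  qed (use that in simp)
  then have eq: "x t = x 0 + integral {0..t} n" if "t \<in> {0..L}" for t using that by simp
  have d: "((\<lambda>t. x 0 + integral {0..t} n) has_vector_derivative n s) (at s within {0..L})"
    using has_vector_derivative_add[OF has_vector_derivative_const integral_has_vector_derivative[OF cont_n, of s]] assms
    by simp
  show ?thesis
    by (rule has_vector_derivative_transform[OF _ eq d]) (use assms in auto)
qed

section \<open>Stationary curves and their end conditions\<close>

lemma stationary_curve_geodesic:
  assumes "stationary_curve L x"
  obtains p w n q where "space_geodesic L p w n q" "n 0 = e_z" "w 0 = 0" "\<And>s. s \<in> {0..L} \<Longrightarrow> x s = w s"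
proof -
  obtain l1 l2 l4 l5 w R where cg: "cuspless_geodesic l1 l2 l4 l5 w R" "0 < L"
    "ereal L \<le> s_max l1 l2 l4 l5" "\<forall>s\<in>{0..L}. x s = w s"
    using assms unfolding stationary_curve_def by blast
  have "R 0 *v e_z = e_z" "w 0 = 0" using cg(1) unfolding cuspless_geodesic_def by simp_all
  then show ?thesis
    using that[OF space_geodesic_of_cuspless[OF cg(1-3)]] cg(4) by blast
qed

lemma stationary_curve_derivative:
  assumes "space_geodesic L p w n q" "\<And>s. s \<in> {0..L} \<Longrightarrow> x s = w s" "s \<in> {0..L}"
  shows "(x has_vector_derivative n s) (at s within {0..L})"
  by (rule has_vector_derivative_transform[OF assms(3,2) space_geodesic.derivative_at_ends[OF assms(1)]])
    (use assms(3) in auto)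

lemma stationary_curve_end_condition:
  assumes "stationary_curve L x" "has_end_condition L x x1 n1"
  obtains p w n q where "space_geodesic L p w n q" "n 0 = e_z" "w 0 = 0" "\<And>s. s \<in> {0..L} \<Longrightarrow> x s = w s"
    "w L = x1" "n L = n1"
proof -
  obtain p w n q where g: "space_geodesic L p w n q" "n 0 = e_z" "w 0 = 0" "\<And>s. s \<in> {0..L} \<Longrightarrow> x s = w s"
    using stationary_curve_geodesic[OF assms(1)] by blast
  have L: "0 < L" using space_geodesic.L_pos[OF g(1)] .
  have "(x has_vector_derivative n L) (at L within cbox 0 L)"
    using stationary_curve_derivative[OF g(1,4), of L] L by simp
  moreover have "(x has_vector_derivative n1) (at L within cbox 0 L)"
    using assms(2) unfolding has_end_condition_def by simp
  ultimately have "n L = n1"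
    using vector_derivative_unique_within_closed_interval[of 0 L L x] L by simp
  moreover have "w L = x1" using assms(2) g(4)[of L] L unfolding has_end_condition_def by simp
  ultimately show ?thesis using that g by blast
qed

text \<open>\<open>e_z \<times> a\<close> is a normal unless \<open>a\<close> is vertical; then
  \<open>e_z \<times> b\<close> serves. If both are vertical, any horizontal vector does.\<close>

lemma coplanar_normal_exists:
  assumes "e_z \<bullet> cross3 a b = 0"
  obtains y where "plane_frame y" "a \<bullet> y = 0" "b \<bullet> y = 0"
proof -
  have "\<exists>v. v \<noteq> 0 \<and> e_z \<bullet> v = 0 \<and> a \<bullet> v = 0 \<and> b \<bullet> v = 0"
  proof (cases "cross3 e_z a = 0")
    case False
    have "b \<bullet> cross3 e_z a = 0"
      using assms cross_triple[of e_z a b] cross_triple[of a b e_z] by (simp add: inner_commute)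
    then show ?thesis using False dot_cross_self by blast
  next
    case a: True
    show ?thesis
    proof (cases "cross3 e_z b = 0")
      case False
      have "a \<bullet> cross3 e_z b = - (cross3 e_z a \<bullet> b)"
        unfolding inner_3 cross3_def vector_3 by algebra
      then show ?thesis using False a dot_cross_self by (intro exI[of _ "cross3 e_z b"]) simp
    next
      case True
      have "a $ 1 = 0" "b $ 1 = 0"
        using a True by (simp_all add: cross3_def vec_eq_iff forall_3)
      moreover have "axis 1 1 \<noteq> (0 :: real^3)" by simp
      ultimately show ?thesis
        by (intro exI[of _ "axis 1 1 :: real^3"]) (simp add: inner_axis)
    qed
  qed
  then obtain v where v: "v \<noteq> 0" "e_z \<bullet> v = 0" "a \<bullet> v = 0" "b \<bullet> v = 0" by blast
  have "plane_frame (sgn v)"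
    by unfold_locales (use v in \<open>simp_all add: sgn_div_norm dot_square_norm power2_eq_square\<close>)
  then show ?thesis by (rule that) (use v in \<open>simp_all add: sgn_div_norm\<close>)
qed

theorem corollary3:
  fixes x1 n1 :: "real^3"
  assumes "admissible_end_condition x1 n1"
    and "e_z \<bullet> cross3 x1 n1 = 0"
  shows "\<exists>L x. stationary_curve L x \<and> connects L x x1 n1 \<and>
           (\<forall>L' x'. stationary_curve L' x' \<and> connects L' x' x1 n1 \<longrightarrow>
              L' = L \<and> (\<forall>s\<in>{0..L}. x' s = x s)) \<and>
           coplanar (x ` {0..L})"
proof -
  obtain L x where st: "stationary_curve L x" and ec: "has_end_condition L x x1 n1"
    using assms(1) unfolding admissible_end_condition_def by blast
  obtain y where y: "plane_frame y" and flat: "x1 \<bullet> y = 0" "n1 \<bullet> y = 0"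
    using coplanar_normal_exists[OF assms(2)] .
  interpret plane_frame y by (rule y)
  note frame_perp = plane_frame.perp[OF y]
  obtain p w n q where g: "space_geodesic L p w n q" "n 0 = e_z" "w 0 = 0" "\<And>s. s \<in> {0..L} \<Longrightarrow> x s = w s"
    "w L = x1" "n L = n1"
    using stationary_curve_end_condition[OF st ec] by blast
  interpret g: space_geodesic L p w n q by (rule g(1))
  have ends: "n 0 \<bullet> y = 0" "n L \<bullet> y = 0" "w L \<bullet> y = w 0 \<bullet> y" using g flat frame_perp by auto
  have planar: "w s \<bullet> y = 0" if "s \<in> {0..L}" for s
    using g.position_planar[OF unit ends, of s] that g(3) by simp
  have "x 0 = 0" using g(3) g(4)[of 0] g.L_pos by simp
  moreover have "(x has_vector_derivative e_z) (at 0 within {0..L})"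
    using stationary_curve_derivative[OF g(1,4), of 0] g(2) g.L_pos by simp
  ultimately have "connects L x x1 n1"
    using ec unfolding connects_def by simp
  moreover have "L' = L \<and> (\<forall>s\<in>{0..L}. x' s = x s)"
    if st': "stationary_curve L' x'" and con': "connects L' x' x1 n1" for L' x'
  proof -
    have "has_end_condition L' x' x1 n1" using con' unfolding connects_def by simp
    then obtain p' w' n' q' where g': "space_geodesic L' p' w' n' q'" "n' 0 = e_z" "w' 0 = 0"
      "\<And>s. s \<in> {0..L'} \<Longrightarrow> x' s = w' s" "w' L' = x1" "n' L' = n1"
      using stationary_curve_end_condition[OF st'] by blast
    interpret g': space_geodesic L' p' w' n' q' by (rule g'(1))
    have ends': "n' 0 \<bullet> y = 0" "n' L' \<bullet> y = 0" "w' L' \<bullet> y = w' 0 \<bullet> y" using g' flat frame_perp by auto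
    have planar': "w' s \<bullet> y = 0" if "s \<in> {0..L'}" for s
      using g'.position_planar[OF unit ends', of s] that g'(3) by simp
    have "geodesic_pair L (plane_coord y p) (\<lambda>s. plane_coord y (w s)) (\<lambda>s. plane_coord y (n s)) (\<lambda>s. q s \<bullet> y)
        L' (plane_coord y p') (\<lambda>s. plane_coord y (w' s)) (\<lambda>s. plane_coord y (n' s)) (\<lambda>s. q' s \<bullet> y)"
      unfolding geodesic_pair_def geodesic_pair_axioms_def
      using g.planar_geodesic_of_planar[OF y ends] g'.planar_geodesic_of_planar[OF y ends'] g g' by simp
    from geodesic_pair.geodesics_coincide[OF this]
    have same: "L = L'" "\<forall>s\<in>{0..L}. plane_coord y (w s) = plane_coord y (w' s)" by auto
    have "w s = w' s" if "s \<in> {0..L}" for s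
      using plane_coord_inject[of "w s" "w' s"] same planar[of s] planar'[of s] that by auto
    then show ?thesis using same(1) g(4) g'(4) by auto
  qed
  moreover have "coplanar (x ` {0..L})"
    by (rule coplanar_of_perp) (use planar g(4) in auto)
  ultimately show ?thesis using st by blast
qed

end
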